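(* Let $p=p(q)\in[0,1]$. As the prime power $q\to\infty$, asymptotically almost surely \[ \alpha(\mathbb{F}_q^2,p)= \begin{cases} \Theta(pq^{2}), & q^{-2+o(1)}\le p\le q^{-3/2-o(1)},\\ q^{1/2+o(1)}, & q^{-3/2-o(1)}\le p\le q^{-1/2+o(1)},\\ \Theta(pq), & q^{-1/2+o(1)}\le p\le 1. \end{cases} \] Moreover, all $q^{o(1)}$ factors here are polylogarithmic in $q$.
   Context: $\mathbb{F}_q$ is the finite field with $q$ elements ($q$ a prime power). A hyperplane in $\mathbb{F}_q^d$ is a $(d-1)$-dimensional affine subspace; a point set $P\subset\mathbb{F}_q^d$ is in general position if no $d+1$ points of $P$ lie in a common hyperplane (for $d=2$: no three points of $P$ are collinear). A $p$-random set $\mathbf{S}_p\subset\mathbb{F}_q^d$ contains each point of $\mathbb{F}_q^d$ independently with probability $p$. $\alpha(\mathbb{F}_q^d,p)$ denotes the maximum size of a general position set contained in $\mathbf{S}_p$. A sequence of events holds asymptotically almost surely (a.a.s.) if its probability tends to $1$ as $q\to\infty$. Asymptotic notation is with respect to $q\to\infty$. *)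

theory Defs
  imports
    "HOL-Algebra.Ring"
    "HOL-Algebra.Coset"
    "HOL-Number_Theory.Prime_Powers"
    "HOL-Library.Landau_Symbols"
    "HOL-Probability.Product_PMF"
begin

definition affine_plane :: "'a ring \<Rightarrow> ('a \<times> 'a) set" where
  "affine_plane K = carrier K \<times> carrier K"

text \<open>Hyperplanes of the plane: translates of the one-dimensional subspaces.\<close>

definition affine_lines :: "'a ring \<Rightarrow> ('a \<times> 'a) set set" where
  "affine_lines K =
     {{(x \<oplus>\<^bsub>K\<^esub> t \<otimes>\<^bsub>K\<^esub> u, y \<oplus>\<^bsub>K\<^esub> t \<otimes>\<^bsub>K\<^esub> v) | t. t \<in> carrier K} | x y u v.
        (x, y) \<in> affine_plane K \<and> (u, v) \<in> affine_plane K \<and> (u, v) \<noteq> (\<zero>\<^bsub>K\<^esub>, \<zero>\<^bsub>K\<^esub>)}"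

definition collinear_in :: "'a ring \<Rightarrow> ('a \<times> 'a) set \<Rightarrow> bool" where
  "collinear_in K T \<longleftrightarrow> (\<exists>L\<in>affine_lines K. T \<subseteq> L)"

definition general_position :: "'a ring \<Rightarrow> ('a \<times> 'a) set \<Rightarrow> bool" where
  "general_position K P \<longleftrightarrow>
     P \<subseteq> affine_plane K \<and> (\<forall>T\<subseteq>P. card T = 3 \<longrightarrow> \<not> collinear_in K T)"

definition gp_number :: "'a ring \<Rightarrow> ('a \<times> 'a) set \<Rightarrow> nat" where
  "gp_number K S = Max {card P | P. P \<subseteq> S \<and> general_position K P}"

text \<open>The random subset of a finite set \<open>A\<close> that contains each element independently with
  probability \<open>p\<close>. Both \<open>Pi_pmf\<close> (finite \<open>A\<close>) and \<open>bernoulli_pmf\<close> (\<open>0 \<le> p \<le> 1\<close>) are only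
  meaningful under these side conditions.\<close>

definition random_subset :: "'b set \<Rightarrow> real \<Rightarrow> 'b set pmf" where
  "random_subset A p = map_pmf (\<lambda>f. {x \<in> A. f x}) (Pi_pmf A False (\<lambda>_. bernoulli_pmf p))"

text \<open>\<open>alpha_pmf K p\<close> is the distribution of \<open>\<alpha>(K\<^sup>2, p)\<close>.\<close>

definition alpha_pmf :: "'a ring \<Rightarrow> real \<Rightarrow> nat pmf" where
  "alpha_pmf K p = map_pmf (gp_number K) (random_subset (affine_plane K) p)"

text \<open>Exponents \<open>\<epsilon>(q) = o(1)\<close> for which the factor \<open>q\<^sup>\<epsilon>\<close> is polylogarithmic in \<open>q\<close>. They are
  nonnegative because every \<open>o(1)\<close> below is written with an explicit sign.\<close>

definition polylog_exponent :: "(nat \<Rightarrow> real) \<Rightarrow> bool" where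
  "polylog_exponent \<epsilon> \<longleftrightarrow>
     (\<forall>q. 0 \<le> \<epsilon> q) \<and> \<epsilon> \<longlonglongrightarrow> 0 \<and>
     (\<exists>k::nat. (\<lambda>q. real q powr \<epsilon> q) \<in> O(\<lambda>q. ln (real q) ^ k))"

definition prime_powers_at_top :: "nat filter" where
  "prime_powers_at_top = inf at_top (principal {q. primepow q})"

end

theory Submission
  imports Defs "HOL-Real_Asymp.Real_Asymp"
begin

text \<open>
  Upper bounds come from a container argument in the style of Kleitman and Winston. Fix an arc \<open>A\<close> of
  about \<open>\<surd>q\<close> points and join two points of the plane when the line through them meets \<open>A\<close>. Each
  \<open>a \<in> A\<close> splits a set \<open>U\<close> into at most \<open>q + 1\<close> classes according to the slope seen from \<open>a\<close>, and a
  pair of points is counted by at most two elements of \<open>A\<close>; hence by Cauchy-Schwarz every \<open>U\<close> with at least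
  \<open>2(q + 1)\<close> points spans edges of density at least of order \<open>1/\<surd>q\<close>. An arc containing \<open>A\<close> is, outside
  \<open>A\<close>, independent in this graph, so all arcs of size at least \<open>\<surd>q\<close> lie in \<open>exp (O(\<surd>q ln\<^sup>2 q))\<close>
  containers with at most \<open>3q\<close> points each. A Chernoff bound and a union bound then give
  \<open>\<alpha> = O(pq + \<surd>q ln\<^sup>2 q)\<close> asymptotically almost surely.

  For the lower bounds, a parabola contributes \<open>\<Omega>(pq)\<close> points, and deleting one point from each of
  the expected \<open>O(p\<^sup>3 q\<^sup>5)\<close> collinear triples leaves \<open>\<Omega>(pq\<^sup>2)\<close> points
  as long as \<open>p \<le> q\<^sup>-\<^sup>3\<^sup>/\<^sup>2 / ln q\<close>; monotonicity in \<open>p\<close> extends this to the middle range.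
\<close>

section \<open>Containers for independent sets\<close>

text \<open>Branch on a vertex \<open>v\<close> of large degree. Sets avoiding \<open>v\<close> lose
  one candidate; sets containing \<open>v\<close> shrink the candidates by the factor
  \<open>1 - \<beta>\<close> at the price of one unit of \<open>l\<close>. Both branches preserve
  the inequality tying \<open>l\<close> to \<open>card U\<close>, so at most \<open>l\<close>
  branches of the second kind occur on a path. This explains the exponent \<open>l\<close> in the
  count and the surcharge \<open>l\<close> for the vertices put back.\<close>

lemma independent_set_containers:
  fixes E :: "'b \<Rightarrow> 'b \<Rightarrow> bool" and \<beta> R :: real
  assumes \<beta>: "\<beta> \<le> 1"
    and deg: "\<And>U. U \<subseteq> V \<Longrightarrow> R < card U \<Longrightarrow> \<exists>v\<in>U. \<beta> * card U \<le> card {u\<in>U. E v u}"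
  assumes "finite U" "U \<subseteq> V" "(1 - \<beta>) ^ l * card U \<le> R"
  shows "\<exists>\<C>. finite \<C> \<and> card \<C> \<le> (card U + 1) ^ l \<and>
           (\<forall>C\<in>\<C>. C \<subseteq> U \<and> card C \<le> R + l) \<and>
           (\<forall>I\<subseteq>U. (\<forall>x\<in>I. \<forall>y\<in>I. \<not> E x y) \<longrightarrow> (\<exists>C\<in>\<C>. I \<subseteq> C))"
  using assms(3-)
proof (induction U arbitrary: l rule: finite_psubset_induct)
  case (psubset U)
  show ?case
  proof (cases "card U \<le> R")
    case True
    show ?thesis by (rule exI[of _ "{U}"]) (use True in auto)
  next
    case False
    \<comment> \<open>For \<open>l = 0\<close> the invariant would read
      \<open>card U \<le> R\<close>.\<close>
    with psubset.prems obtain k where l: "l = Suc k" by (cases l) auto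
    from deg[OF psubset.prems(1)] False obtain v
      where v: "v \<in> U" "\<beta> * card U \<le> card {u\<in>U. E v u}" by auto
    \<comment> \<open>An independent set either omits \<open>v\<close> or omits all its neighbours.\<close>
    define U1 where "U1 = U - {v}"
    define U2 where "U2 = {u\<in>U. \<not> E v u} - {v}"
    have ps: "U1 \<subset> U" "U2 \<subset> U" using v by (auto simp: U1_def U2_def)
    then have V: "U1 \<subseteq> V" "U2 \<subseteq> V" using psubset.prems(1) by auto
    have cU: "card U1 + 1 = card U" using v psubset.hyps unfolding U1_def
      by (metis Suc_eq_plus1 card_Suc_Diff1)
    have c2: "card U2 + 1 \<le> card U" using psubset_card_mono[OF psubset.hyps ps(2)] by simp
    have "card (U2 \<union> {u\<in>U. E v u}) \<le> card U"
      using psubset.hyps by (intro card_mono) (auto simp: U2_def)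
    moreover have "card (U2 \<union> {u\<in>U. E v u}) = card U2 + card {u\<in>U. E v u}"
      using psubset.hyps by (intro card_Un_disjoint) (auto simp: U2_def)
    ultimately have "card U2 \<le> (1 - \<beta>) * card U" using v(2) by (simp add: algebra_simps)
    then have "(1 - \<beta>) ^ k * card U2 \<le> (1 - \<beta>) ^ k * ((1 - \<beta>) * card U)"
      using \<beta> by (intro mult_left_mono) auto
    then have r2: "(1 - \<beta>) ^ k * card U2 \<le> R" using psubset.prems(2) l by (simp add: mult_ac)
    have "(1 - \<beta>) ^ l * card U1 \<le> (1 - \<beta>) ^ l * card U"
      using \<beta> cU by (intro mult_left_mono) auto
    then have r1: "(1 - \<beta>) ^ l * card U1 \<le> R" using psubset.prems(2) by simp
    obtain \<C>1 where C1: "finite \<C>1" "card \<C>1 \<le> (card U1 + 1) ^ l"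
        "\<forall>C\<in>\<C>1. C \<subseteq> U1 \<and> card C \<le> R + l"
        "\<forall>I\<subseteq>U1. (\<forall>x\<in>I. \<forall>y\<in>I. \<not> E x y) \<longrightarrow> (\<exists>C\<in>\<C>1. I \<subseteq> C)"
      using psubset.IH[OF ps(1) V(1) r1] by (elim exE conjE) (rule that)
    obtain \<C>2 where C2: "finite \<C>2" "card \<C>2 \<le> (card U2 + 1) ^ k"
        "\<forall>C\<in>\<C>2. C \<subseteq> U2 \<and> card C \<le> R + k"
        "\<forall>I\<subseteq>U2. (\<forall>x\<in>I. \<forall>y\<in>I. \<not> E x y) \<longrightarrow> (\<exists>C\<in>\<C>2. I \<subseteq> C)"
      using psubset.IH[OF ps(2) V(2) r2] by (elim exE conjE) (rule that)
    show ?thesis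
    proof (intro exI[of _ "\<C>1 \<union> insert v ` \<C>2"] conjI ballI allI impI)
      show "finite (\<C>1 \<union> insert v ` \<C>2)" using C1 C2 by simp
      have "card (\<C>1 \<union> insert v ` \<C>2) \<le> card \<C>1 + card \<C>2"
        by (rule order.trans[OF card_Un_le]) (simp add: C2 card_image_le)
      \<comment> \<open>Both branches have lost at least \<open>v\<close>, so both counts are
        bounded by powers of \<open>card U\<close> and their sum factors.\<close>
      also have "\<dots> \<le> card U ^ l + card U ^ k"
        using C1(2) C2(2) cU power_mono[OF c2, of k] by simp
      also have "\<dots> = (card U + 1) * card U ^ k" by (simp add: l)
      also have "\<dots> \<le> (card U + 1) ^ l" unfolding l power_Suc
        by (intro mult_left_mono power_mono) auto
      finally show "card (\<C>1 \<union> insert v ` \<C>2) \<le> (card U + 1) ^ l" .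
    next
      fix C assume C: "C \<in> \<C>1 \<union> insert v ` \<C>2"
      then show "C \<subseteq> U" using C1(3) C2(3) ps v by blast
      from C show "card C \<le> R + l"
      proof
        assume "C \<in> \<C>1" then show ?thesis using C1(3) by simp
      next
        assume "C \<in> insert v ` \<C>2"
        then obtain C' where C': "C' \<in> \<C>2" "C = insert v C'" by blast
        have "card C \<le> card C' + 1" unfolding C' by (simp add: card_insert_le_m1 card_insert_if)
        moreover have "card C' \<le> R + k" using C2(3) C'(1) by blast
        ultimately show ?thesis by (simp add: l)
      qed
    next
      fix I assume I: "I \<subseteq> U" "\<forall>x\<in>I. \<forall>y\<in>I. \<not> E x y"
      show "\<exists>C\<in>\<C>1 \<union> insert v ` \<C>2. I \<subseteq> C"
      proof (cases "v \<in> I")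
        case True
        have "I - {v} \<subseteq> U2" using I True by (auto simp: U2_def)
        with C2(4) I(2) obtain C where "C \<in> \<C>2" "I - {v} \<subseteq> C" by (metis DiffD1)
        then show ?thesis by blast
      next
        case False
        with I have "I \<subseteq> U1" by (auto simp: U1_def)
        with C1(4) I(2) obtain C where "C \<in> \<C>1" "I \<subseteq> C" by metis
        then show ?thesis by blast
      qed
    qed
  qed
qed

text \<open>Cauchy-Schwarz for the fibre sizes of \<open>f\<close>: the sum counts ordered pairs in
  a common fibre, diagonal included, and so equals the sum of the squared fibre sizes.\<close>

lemma card_sq_le_collisions:
  fixes f :: "'b \<Rightarrow> 'c"
  assumes "finite U" "finite D" "f ` U \<subseteq> D"
  shows "(card U)\<^sup>2 \<le> card D * (\<Sum>x\<in>U. card {y\<in>U. f y = f x})"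
proof -
  define n where "n d = card {y\<in>U. f y = d}" for d
  have "(\<Sum>x\<in>U. n (f x)) = (\<Sum>d\<in>D. \<Sum>x\<in>{x\<in>U. f x = d}. n (f x))"
    using assms by (intro sum.group[symmetric]) auto
  also have "\<dots> = (\<Sum>d\<in>D. (n d)\<^sup>2)"
    by (intro sum.cong) (auto simp: n_def power2_eq_square)
  finally have sq: "(\<Sum>x\<in>U. n (f x)) = (\<Sum>d\<in>D. (n d)\<^sup>2)" .
  have "card U = (\<Sum>x\<in>U. 1)" by simp
  also have "\<dots> = (\<Sum>d\<in>D. \<Sum>x\<in>{x\<in>U. f x = d}. 1)"
    using assms by (intro sum.group[symmetric]) auto
  also have "\<dots> = (\<Sum>d\<in>D. n d)" by (simp add: n_def)
  finally have "real ((card U)\<^sup>2) = (\<Sum>d\<in>D. real (n d))\<^sup>2" by simp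
  also have "\<dots> \<le> (\<Sum>d\<in>D. (real (n d))\<^sup>2) * card D" by (rule sum_squared_le_sum_of_squares)
  also have "\<dots> = real (card D * (\<Sum>x\<in>U. n (f x)))" unfolding sq by simp
  finally show ?thesis unfolding n_def by (simp only: of_nat_le_iff)
qed

text \<open>Averaging. For each \<open>a\<close>, Cauchy-Schwarz gives at least
  \<open>(card U)^2 / (2 * card D)\<close> ordered pairs of distinct points that \<open>f a\<close>
  does not separate. Summing over \<open>A\<close> counts each pair at most twice, so the average
  degree already reaches the bound.\<close>

lemma exists_large_degree:
  fixes f :: "'a \<Rightarrow> 'b \<Rightarrow> 'c"
  assumes fin: "finite A" "finite U" "finite D" and "D \<noteq> {}"
    and maps: "\<And>a. a \<in> A \<Longrightarrow> f a ` U \<subseteq> D"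
    and mult: "\<And>x y. x \<in> U \<Longrightarrow> y \<in> U \<Longrightarrow> x \<noteq> y \<Longrightarrow> card {a\<in>A. f a x = f a y} \<le> 2"
    and large: "2 * card D \<le> card U"
  shows "\<exists>v\<in>U. real (card A) / (4 * card D) * card U
                  \<le> card {u\<in>U. v \<noteq> u \<and> (\<exists>a\<in>A. f a v = f a u)}"
proof (rule ccontr)
  define N where "N v = {u\<in>U. v \<noteq> u \<and> (\<exists>a\<in>A. f a v = f a u)}" for v
  assume "\<not> ?thesis"
  then have small: "real (card (N v)) < real (card A) / (4 * card D) * card U" if "v \<in> U" for v
    using that by (auto simp: N_def not_le)
  have d: "0 < card D" using fin \<open>D \<noteq> {}\<close> by (simp add: card_gt_0_iff)
  with large have U0: "0 < card U" by simp
  define T where "T a v = card {u\<in>U. v \<noteq> u \<and> f a v = f a u}" for a v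
  have T: "card {u\<in>U. f a u = f a v} = T a v + 1" if "v \<in> U" for a v
  proof -
    have "{u\<in>U. f a u = f a v} = insert v {u\<in>U. v \<noteq> u \<and> f a v = f a u}" using that by auto
    then show ?thesis using fin by (simp add: T_def)
  qed
  have low: "(real (card U))\<^sup>2 \<le> 2 * card D * real (\<Sum>v\<in>U. T a v)" if "a \<in> A" for a
  proof -
    have "(card U)\<^sup>2 \<le> card D * ((\<Sum>v\<in>U. T a v) + card U)"
      using card_sq_le_collisions[OF fin(2,3) maps[OF that]]
      by (simp only: T sum.distrib sum_constant mult_1_right of_nat_id cong: sum.cong)
    \<comment> \<open>The diagonal pairs contribute \<open>card D * card U\<close>, which
      \<open>large\<close> makes at most half of the square.\<close>
    moreover have "2 * card D * card U \<le> (card U)\<^sup>2" unfolding power2_eq_square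
      by (intro mult_right_mono large) auto
    ultimately have "(card U)\<^sup>2 \<le> 2 * card D * (\<Sum>v\<in>U. T a v)" by (simp add: algebra_simps)
    then have "real ((card U)\<^sup>2) \<le> real (2 * card D * (\<Sum>v\<in>U. T a v))" by (rule of_nat_mono)
    then show ?thesis by simp
  qed
  have up: "(\<Sum>a\<in>A. T a v) \<le> 2 * card (N v)" if v: "v \<in> U" for v
  proof -
    have "(\<Sum>a\<in>A. T a v) = (\<Sum>a\<in>A. \<Sum>u\<in>N v. if f a v = f a u then 1 else 0)"
      using fin by (intro sum.cong refl) (auto simp: T_def N_def sum.If_cases intro!: arg_cong[of _ _ card])
    also have "\<dots> = (\<Sum>u\<in>N v. \<Sum>a\<in>A. if f a v = f a u then 1 else 0)" by (rule sum.swap)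
    also have "\<dots> = (\<Sum>u\<in>N v. card {a\<in>A. f a v = f a u})"
      using fin by (simp add: sum.If_cases Int_def)
    also have "\<dots> \<le> (\<Sum>u\<in>N v. 2)" using v by (intro sum_mono mult) (auto simp: N_def)
    finally show ?thesis by simp
  qed
  \<comment> \<open>The chain starts and ends at the same number; its strict step sums
    \<open>small\<close> over the nonempty set \<open>U\<close>.\<close>
  have "card A * (real (card U))\<^sup>2 \<le> (\<Sum>a\<in>A. 2 * card D * real (\<Sum>v\<in>U. T a v))"
    using sum_mono[of A "\<lambda>_. (real (card U))\<^sup>2", OF low] by simp
  also have "\<dots> = 2 * card D * real (\<Sum>v\<in>U. \<Sum>a\<in>A. T a v)"
    by (subst sum.swap) (simp add: sum_distrib_left)
  also have "\<dots> \<le> 2 * card D * real (\<Sum>v\<in>U. 2 * card (N v))"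
    by (intro mult_left_mono of_nat_mono sum_mono up) auto
  also have "\<dots> = 4 * card D * (\<Sum>v\<in>U. real (card (N v)))" by (simp add: sum_distrib_left mult.assoc)
  also have "\<dots> < 4 * card D * (\<Sum>v\<in>U. real (card A) / (4 * card D) * card U)"
    using d U0 fin(2) by (intro mult_strict_left_mono sum_strict_mono small) auto
  also have "\<dots> = card A * (real (card U))\<^sup>2" using d by (simp add: power2_eq_square)
  finally show False by simp
qed

section \<open>Random subsets\<close>

text \<open>The power is a product of independent factors, one for each point of \<open>A\<close>,
  and points outside \<open>C\<close> contribute 1. The values \<open>e\<close> and
  \<open>1/e\<close> of \<open>z\<close> give the two tail bounds.\<close>

lemma expectation_power_card_random_subset:
  fixes z :: real
  assumes A: "finite A" "C \<subseteq> A" and p: "0 \<le> p" "p \<le> 1" and z: "0 \<le> z"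
  shows "measure_pmf.expectation (random_subset A p) (\<lambda>S. z ^ card (S \<inter> C)) = (1 - p + p * z) ^ card C"
proof -
  have "measure_pmf.expectation (random_subset A p) (\<lambda>S. z ^ card (S \<inter> C))
     = measure_pmf.expectation (Pi_pmf A False (\<lambda>_. bernoulli_pmf p))
        (\<lambda>f. \<Prod>x\<in>A. if x \<in> C \<and> f x then z else 1)"
    unfolding random_subset_def integral_map_pmf
  proof (intro Bochner_Integration.integral_cong refl)
    fix f
    have "(\<Prod>x\<in>A. if x \<in> C \<and> f x then z else 1) = z ^ card (A \<inter> {x. x \<in> C \<and> f x})"
      using A by (simp add: prod.If_cases)
    also have "A \<inter> {x. x \<in> C \<and> f x} = {x \<in> A. f x} \<inter> C" by auto
    finally show "z ^ card ({x \<in> A. f x} \<inter> C) = (\<Prod>x\<in>A. if x \<in> C \<and> f x then z else 1)" by simp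
  qed
  also have "\<dots> = (\<Prod>x\<in>A. measure_pmf.expectation (bernoulli_pmf p) (\<lambda>b. if x \<in> C \<and> b then z else 1))"
    using A z by (intro expectation_prod_Pi_pmf) (auto intro: integrable_measure_pmf_finite)
  also have "\<dots> = (\<Prod>x\<in>A. if x \<in> C then 1 - p + p * z else 1)"
    using p by (intro prod.cong) (auto simp: algebra_simps)
  also have "\<dots> = (1 - p + p * z) ^ card C"
    using A by (simp add: prod.If_cases Int_absorb1)
  finally show ?thesis .
qed

lemma finite_set_random_subset:
  assumes "finite A" shows "finite (set_pmf (random_subset A p))" "set_pmf (random_subset A p) \<subseteq> Pow A"
proof -
  show *: "set_pmf (random_subset A p) \<subseteq> Pow A" by (auto simp: random_subset_def)
  show "finite (set_pmf (random_subset A p))" using finite_subset[OF *] assms by simp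
qed

lemma prob_le_expectation:
  fixes M :: "'b pmf" and g :: "'b \<Rightarrow> real"
  assumes "finite (set_pmf M)" "\<And>x. x \<in> set_pmf M \<Longrightarrow> 0 \<le> g x" "\<And>x. x \<in> set_pmf M \<Longrightarrow> Q x \<Longrightarrow> 1 \<le> g x"
  shows "measure_pmf.prob M {x. Q x} \<le> measure_pmf.expectation M g"
proof -
  have "measure_pmf.prob M {x. Q x} = measure_pmf.expectation M (indicator {x. Q x})" by simp
  also have "\<dots> \<le> measure_pmf.expectation M g"
    using assms by (intro integral_mono_AE integrable_measure_pmf_finite)
      (auto simp: AE_measure_pmf_iff indicator_def)
  finally show ?thesis .
qed

text \<open>Exponential moment method with the parameter fixed at 1, which is enough for bounds up
  to constant factors; \<open>e \<le> 3\<close> bounds each factor by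
  \<open>exp (2 * p)\<close>.\<close>

lemma random_subset_upper_tail:
  assumes A: "finite A" "C \<subseteq> A" and p: "0 \<le> p" "p \<le> 1"
  shows "measure_pmf.prob (random_subset A p) {S. t \<le> real (card (S \<inter> C))}
           \<le> exp (2 * p * card C - t)"
proof -
  let ?M = "random_subset A p"
  have "measure_pmf.prob ?M {S. t \<le> real (card (S \<inter> C))}
          \<le> measure_pmf.expectation ?M (\<lambda>S. exp (- t) * exp 1 ^ card (S \<inter> C))"
    using A by (intro prob_le_expectation finite_set_random_subset)
      (auto simp flip: exp_of_nat_mult exp_add)
  also have "\<dots> = exp (- t) * (1 - p + p * exp 1) ^ card C"
    using expectation_power_card_random_subset[OF A p, of "exp 1"] by simp
  also have "\<dots> \<le> exp (- t) * exp (2 * p) ^ card C"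
  proof (intro mult_left_mono power_mono)
    have "exp 1 \<le> (3 :: real)" by (rule exp_le)
    then have "p * exp 1 \<le> p * 3" using p by (intro mult_left_mono)
    then have "1 - p + p * exp 1 \<le> 1 + 2 * p" by simp
    also have "\<dots> \<le> exp (2 * p)" by (rule exp_ge_add_one_self)
    finally show "1 - p + p * exp 1 \<le> exp (2 * p)" .
  qed (use p in auto)
  also have "\<dots> = exp (2 * p * card C - t)"
    by (simp flip: exp_of_nat_mult exp_add add: algebra_simps)
  finally show ?thesis .
qed

text \<open>Exponential moments with parameter -1; \<open>exp (-1) \<le> 1/2\<close> bounds each
  factor by \<open>exp (- p / 2)\<close>.\<close>

lemma random_subset_lower_tail:
  assumes A: "finite A" "C \<subseteq> A" and p: "0 \<le> p" "p \<le> 1"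
  shows "measure_pmf.prob (random_subset A p) {S. real (card (S \<inter> C)) \<le> t}
           \<le> exp (t - p * card C / 2)"
proof -
  let ?M = "random_subset A p"
  have "measure_pmf.prob ?M {S. real (card (S \<inter> C)) \<le> t}
          \<le> measure_pmf.expectation ?M (\<lambda>S. exp t * exp (-1) ^ card (S \<inter> C))"
    using A by (intro prob_le_expectation finite_set_random_subset)
      (auto simp flip: exp_of_nat_mult exp_add)
  also have "\<dots> = exp t * (1 - p + p * exp (-1)) ^ card C"
    using expectation_power_card_random_subset[OF A p, of "exp (-1)"] by simp
  also have "\<dots> \<le> exp t * exp (- p / 2) ^ card C"
  proof (intro mult_left_mono power_mono)
    have "2 \<le> exp (1 :: real)" using exp_ge_add_one_self[of 1] by simp
    then have "exp (-1) \<le> (1 / 2 :: real)" by (simp add: exp_minus field_simps)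
    then have "p * exp (-1) \<le> p * (1 / 2)" using p by (intro mult_left_mono)
    then have "1 - p + p * exp (-1) \<le> 1 + (- p / 2)" by simp
    also have "\<dots> \<le> exp (- p / 2)" by (rule exp_ge_add_one_self)
    finally show "1 - p + p * exp (-1) \<le> exp (- p / 2)" .
  qed (use p in auto)
  also have "\<dots> = exp (t - p * card C / 2)"
    by (simp flip: exp_of_nat_mult exp_add add: algebra_simps)
  finally show ?thesis .
qed

lemma prob_subset_random_subset:
  assumes A: "finite A" "T \<subseteq> A" and p: "0 \<le> p" "p \<le> 1"
  shows "measure_pmf.prob (random_subset A p) {S. T \<subseteq> S} = p ^ card T"
proof -
  have "measure_pmf.prob (random_subset A p) {S. T \<subseteq> S}
      = measure_pmf.prob (Pi_pmf A False (\<lambda>_. bernoulli_pmf p)) (Pi A (\<lambda>x. if x \<in> T then {True} else UNIV))"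
    using A by (auto simp: random_subset_def Pi_def intro!: arg_cong[where f = "measure_pmf.prob _"])
  also have "\<dots> = (\<Prod>x\<in>A. if x \<in> T then p else 1)"
    unfolding measure_Pi_pmf_Pi[OF A(1)] using p
    by (intro prod.cong) (auto simp: measure_pmf_single)
  also have "\<dots> = p ^ card T" using A by (simp add: prod.If_cases Int_absorb1)
  finally show ?thesis .
qed

text \<open>Markov's inequality: by linearity the expected number of members inside the random set
  is \<open>card \<T> * p ^ k\<close>.\<close>

lemma random_subset_few_members:
  fixes p t :: real
  assumes A: "finite A" and p: "0 \<le> p" "p \<le> 1" and \<T>: "\<T> \<subseteq> Pow A" "\<And>T. T \<in> \<T> \<Longrightarrow> card T = k" and t: "0 < t"
  shows "measure_pmf.prob (random_subset A p) {S. t \<le> real (card {T\<in>\<T>. T \<subseteq> S})} \<le> card \<T> * p ^ k / t"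
proof -
  let ?M = "random_subset A p"
  have fin: "finite \<T>" using A \<T>(1) finite_subset by blast
  have "measure_pmf.prob ?M {S. t \<le> real (card {T\<in>\<T>. T \<subseteq> S})}
     \<le> measure_pmf.expectation ?M (\<lambda>S. (\<Sum>T\<in>\<T>. indicator {S. T \<subseteq> S} S) / t)"
    using A t fin by (intro prob_le_expectation finite_set_random_subset)
      (auto simp: indicator_def sum.If_cases Int_def intro!: divide_nonneg_pos)
  also have "\<dots> = (\<Sum>T\<in>\<T>. measure_pmf.prob ?M {S. T \<subseteq> S}) / t"
    using A finite_set_random_subset[OF A] by (simp add: Bochner_Integration.integral_sum integrable_measure_pmf_finite)
  also have "(\<Sum>T\<in>\<T>. measure_pmf.prob ?M {S. T \<subseteq> S}) = (\<Sum>T\<in>\<T>. p ^ k)"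
    using \<T> by (intro sum.cong refl) (subst prob_subset_random_subset[OF A(1)], auto simp: p)
  finally show ?thesis by simp
qed

text \<open>Coupling: thinning a \<open>p\<close>-random set by independent coins of bias
  \<open>p' / p\<close> leaves a \<open>p'\<close>-random subset of it, and increasing events pass
  to the larger set.\<close>

lemma random_subset_mono:
  assumes A: "finite A" and p: "0 \<le> p'" "p' \<le> p" "p \<le> 1"
    and Q: "\<And>S S'. S \<subseteq> S' \<Longrightarrow> S' \<subseteq> A \<Longrightarrow> Q S \<Longrightarrow> Q S'"
  shows "measure_pmf.prob (random_subset A p') {S. Q S} \<le> measure_pmf.prob (random_subset A p) {S. Q S}"
proof -
  \<comment> \<open>If \<open>p = 0\<close>, then \<open>p' = 0\<close> and the quotient is 0 by
    convention, so \<open>p * r = p'\<close> holds there too.\<close>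
  define r where "r = p' / p"
  have r: "0 \<le> r" "r \<le> 1" "p * r = p'" using p by (auto simp: r_def divide_le_eq_1)
  define B where "B = pair_pmf (bernoulli_pmf p) (bernoulli_pmf r)"
  define M where "M = Pi_pmf A (False, False) (\<lambda>_. B)"
  have 1: "map_pmf fst B = bernoulli_pmf p" unfolding B_def by (rule map_fst_pair_pmf)
  have 2: "map_pmf (\<lambda>(a, b). a \<and> b) B = bernoulli_pmf p'"
  proof (rule pmf_eqI)
    fix x
    have *: "(\<lambda>(a, b). a \<and> b) -` {True} = {(True, True)}" by auto
    have t: "pmf (map_pmf (\<lambda>(a, b). a \<and> b) B) True = p'"
      using p r by (simp add: pmf_map * B_def measure_pmf_single pmf_pair)
    moreover have "pmf N False = 1 - pmf N True" for N :: "bool pmf"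
      using sum_pmf_eq_1[OF finite[of UNIV] subset_UNIV, of N] unfolding UNIV_bool by simp
    ultimately show "pmf (map_pmf (\<lambda>(a, b). a \<and> b) B) x = pmf (bernoulli_pmf p') x"
      using p by (cases x) auto
  qed
  have M1: "random_subset A p = map_pmf (\<lambda>f. {x\<in>A. fst (f x)}) M"
    unfolding random_subset_def 1[symmetric] M_def
    by (subst Pi_pmf_map[OF A, where dflt = "(False, False)"]) (auto simp: map_pmf_comp)
  have M2: "random_subset A p' = map_pmf (\<lambda>f. {x\<in>A. fst (f x) \<and> snd (f x)}) M"
    unfolding random_subset_def 2[symmetric] M_def
    by (subst Pi_pmf_map[OF A, where dflt = "(False, False)"])
      (auto simp: map_pmf_comp case_prod_unfold)
  show ?thesis unfolding M1 M2 measure_map_pmf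
    by (intro measure_pmf.finite_measure_mono) (auto elim!: Q[rotated 2])
qed

section \<open>The plane over a finite field\<close>

locale finite_plane = field K for K :: "'a ring" (structure) +
  assumes finite_carrier: "finite (carrier K)"
begin

abbreviation "plane \<equiv> affine_plane K"
abbreviation "q \<equiv> card (carrier K)"

text \<open>The direction from \<open>a\<close> to \<open>x\<close> as a point of the projective
  line, with \<open>None\<close> for the vertical one; there are \<open>q + 1\<close> values. The
  degenerate \<open>slope a a\<close> is \<open>None\<close> as well.\<close>

definition slope :: "'a \<times> 'a \<Rightarrow> 'a \<times> 'a \<Rightarrow> 'a option" where
  "slope a x = (if fst x = fst a then None
     else Some ((snd x \<ominus> snd a) \<otimes> inv (fst x \<ominus> fst a)))"

definition affine_comb :: "'a \<times> 'a \<Rightarrow> 'a \<times> 'a \<Rightarrow> 'a \<Rightarrow> 'a \<times> 'a" where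
  "affine_comb x y t =
     (fst x \<oplus> t \<otimes> (fst y \<ominus> fst x), snd x \<oplus> t \<otimes> (snd y \<ominus> snd x))"

definition parabola :: "('a \<times> 'a) set" where
  "parabola = (\<lambda>x. (x, x \<otimes> x)) ` carrier K"

definition collinear_triples :: "('a \<times> 'a) set set" where
  "collinear_triples = {T. T \<subseteq> plane \<and> card T = 3 \<and> collinear_in K T}"

lemma finite_affine_plane [simp]: "finite plane"
  using finite_carrier by (simp add: affine_plane_def)

lemma card_plane: "card plane = q\<^sup>2"
  by (simp add: affine_plane_def power2_eq_square card_cartesian_product)

lemma q_ge_2: "2 \<le> q"
proof -
  have "card {\<zero>, \<one>} \<le> q" using finite_carrier by (intro card_mono) auto
  then show ?thesis by simp
qed

section \<open>Directions and lines\<close>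

lemma minus_eq_zero_iff:
  assumes "x \<in> carrier K" "y \<in> carrier K"
  shows "x \<ominus> y = \<zero> \<longleftrightarrow> x = y"
proof
  assume *: "x \<ominus> y = \<zero>"
  have "x = (x \<ominus> y) \<oplus> y" using assms by algebra
  with * assms show "x = y" by simp
qed (use assms in \<open>simp add: minus_eq r_neg\<close>)

lemma diff_unit:
  assumes "x \<in> carrier K" "y \<in> carrier K" "x \<noteq> y"
  shows "x \<ominus> y \<in> Units K"
  using assms by (simp add: field_Units minus_eq_zero_iff)

lemma slope_mem:
  assumes "a \<in> plane" "x \<in> plane"
  shows "slope a x \<in> insert None (Some ` carrier K)"
proof (cases "fst x = fst a")
  case False
  have "fst x \<ominus> fst a \<in> Units K" using assms False by (intro diff_unit) (auto simp: affine_plane_def)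
  then show ?thesis using assms by (auto simp: slope_def affine_plane_def)
qed (simp add: slope_def)

lemma line_mem:
  assumes "(x, y) \<in> plane" "(u, v) \<in> plane" "(u, v) \<noteq> (\<zero>, \<zero>)"
  shows "{(x \<oplus> t \<otimes> u, y \<oplus> t \<otimes> v) | t. t \<in> carrier K} \<in> affine_lines K"
  using assms unfolding affine_lines_def by blast

lemma add_diff_cancel:
  assumes "a \<in> carrier K" "b \<in> carrier K"
  shows "a \<oplus> (b \<ominus> a) = b"
  using assms by algebra

text \<open>Both points lie on the line through \<open>a\<close> with direction
  \<open>(0, 1)\<close> for \<open>None\<close> and \<open>(1, m)\<close> for \<open>Some m\<close>;
  the parameter of a point is a coordinate difference to \<open>a\<close>.\<close>

lemma collinear_if_slope_eq:
  assumes "a \<in> plane" "x \<in> plane" "y \<in> plane" "slope a x = slope a y"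
  shows "collinear_in K {a, x, y}"
proof -
  obtain a1 a2 where a: "a = (a1, a2)" "a1 \<in> carrier K" "a2 \<in> carrier K"
    using assms by (auto simp: affine_plane_def)
  have on_line: "\<exists>t\<in>carrier K. z = (a1 \<oplus> t \<otimes> \<zero>, a2 \<oplus> t \<otimes> \<one>)"
    if "z \<in> plane" "slope a z = None" for z
    using that a by (intro bexI[of _ "snd z \<ominus> a2"])
      (auto simp: affine_plane_def slope_def add_diff_cancel split: if_splits)
  have on_line': "\<exists>t\<in>carrier K. z = (a1 \<oplus> t \<otimes> \<one>, a2 \<oplus> t \<otimes> m)"
    if z: "z \<in> plane" "slope a z = Some m" for z m
  proof -
    obtain z1 z2 where zz: "z = (z1, z2)" "z1 \<in> carrier K" "z2 \<in> carrier K"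
      using z by (auto simp: affine_plane_def)
    have ne: "z1 \<noteq> a1" and m: "m = (z2 \<ominus> a2) \<otimes> inv (z1 \<ominus> a1)"
      using z zz a by (auto simp: slope_def split: if_splits)
    have u: "z1 \<ominus> a1 \<in> Units K" using ne zz a by (intro diff_unit)
    have "(z1 \<ominus> a1) \<otimes> m = (z2 \<ominus> a2) \<otimes> ((z1 \<ominus> a1) \<otimes> inv (z1 \<ominus> a1))"
      unfolding m using u zz a by (intro m_lcomm) auto
    also have "\<dots> = z2 \<ominus> a2" using u zz a by (simp add: Units_r_inv)
    finally show ?thesis using zz a
      by (intro bexI[of _ "z1 \<ominus> a1"]) (auto simp: add_diff_cancel)
  qed
  show ?thesis
  proof (cases "slope a x")
    case None
    let ?L = "{(a1 \<oplus> t \<otimes> \<zero>, a2 \<oplus> t \<otimes> \<one>) | t. t \<in> carrier K}"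
    have "?L \<in> affine_lines K" using a by (intro line_mem) (auto simp: affine_plane_def)
    moreover have "slope a a = None" by (simp add: slope_def)
    then have "{a, x, y} \<subseteq> ?L"
      using on_line[OF assms(1)] on_line[OF assms(2) None] on_line[OF assms(3)] unfolding assms(4)[symmetric] None by blast
    ultimately show ?thesis unfolding collinear_in_def by blast
  next
    case (Some m)
    let ?L = "{(a1 \<oplus> t \<otimes> \<one>, a2 \<oplus> t \<otimes> m) | t. t \<in> carrier K}"
    have m: "m \<in> carrier K" using slope_mem[OF assms(1,2)] Some by auto
    then have "?L \<in> affine_lines K" using a by (intro line_mem) (auto simp: affine_plane_def)
    \<comment> \<open>\<open>on_line'\<close> does not cover \<open>a\<close>, whose slope from
      itself is \<open>None\<close>; parameter zero puts it on the line.\<close>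
    moreover have "a = (a1 \<oplus> \<zero> \<otimes> \<one>, a2 \<oplus> \<zero> \<otimes> m)" using a m by simp
    then have "{a, x, y} \<subseteq> ?L"
      using on_line'[OF assms(2) Some] on_line'[OF assms(3)] zero_closed
      unfolding assms(4)[symmetric] Some by blast
    ultimately show ?thesis unfolding collinear_in_def by blast
  qed
qed

text \<open>One coordinate of the change of parameter on a line that sends \<open>r\<close> to 0 and
  \<open>s\<close> to 1.\<close>

lemma affine_comb_of_params:
  assumes "p \<in> carrier K" "u \<in> carrier K" "r \<in> carrier K" "s \<in> carrier K" "t \<in> carrier K" "w \<in> carrier K"
    and "t = r \<oplus> w \<otimes> (s \<ominus> r)"
  shows "p \<oplus> t \<otimes> u = (p \<oplus> r \<otimes> u) \<oplus> w \<otimes> ((p \<oplus> s \<otimes> u) \<ominus> (p \<oplus> r \<otimes> u))"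
  unfolding assms(7) using assms(1-6) by algebra

text \<open>Distinct points have distinct parameters \<open>r\<close> and \<open>s\<close> on the
  line, so \<open>s \<ominus> r\<close> is invertible and the new parameter of \<open>z\<close> is
  the quotient \<open>w\<close>.\<close>

lemma affine_comb_if_collinear:
  assumes "collinear_in K {x, y, z}" "x \<noteq> y"
  shows "\<exists>t\<in>carrier K. z = affine_comb x y t"
proof -
  from assms(1) obtain L where L: "L \<in> affine_lines K" "{x, y, z} \<subseteq> L" unfolding collinear_in_def by blast
  from L(1) obtain p1 p2 u v where c: "p1 \<in> carrier K" "p2 \<in> carrier K" "u \<in> carrier K" "v \<in> carrier K"
    and L_eq: "L = {(p1 \<oplus> t \<otimes> u, p2 \<oplus> t \<otimes> v) | t. t \<in> carrier K}"
    unfolding affine_lines_def affine_plane_def by blast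
  have on_L: "\<exists>t. t \<in> carrier K \<and> w = (p1 \<oplus> t \<otimes> u, p2 \<oplus> t \<otimes> v)" if "w \<in> L" for w
    using that unfolding L_eq by blast
  from on_L[of x] on_L[of y] on_L[of z] L(2) obtain r s t where
    x: "r \<in> carrier K" "x = (p1 \<oplus> r \<otimes> u, p2 \<oplus> r \<otimes> v)" and
    y: "s \<in> carrier K" "y = (p1 \<oplus> s \<otimes> u, p2 \<oplus> s \<otimes> v)" and
    z: "t \<in> carrier K" "z = (p1 \<oplus> t \<otimes> u, p2 \<oplus> t \<otimes> v)" by auto
  have "s \<noteq> r" using assms(2) x y by auto
  then have un: "s \<ominus> r \<in> Units K" using x y by (intro diff_unit)
  define w where "w = (t \<ominus> r) \<otimes> inv (s \<ominus> r)"
  have w: "w \<in> carrier K" unfolding w_def using un x y z by simp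
  have "w \<otimes> (s \<ominus> r) = t \<ominus> r"
    unfolding w_def using un x y z by (simp add: m_assoc)
  then have "t = r \<oplus> w \<otimes> (s \<ominus> r)" using x z by (simp add: add_diff_cancel)
  from affine_comb_of_params[OF c(1,3) x(1) y(1) z(1) w this] affine_comb_of_params[OF c(2,4) x(1) y(1) z(1) w this]
  show ?thesis using w by (intro bexI[of _ w]) (simp_all add: affine_comb_def x y z)
qed

lemma affine_comb_line:
  assumes "x \<in> plane" "y \<in> plane" "x \<noteq> y"
  shows "{affine_comb x y t | t. t \<in> carrier K} \<in> affine_lines K"
proof -
  have "fst y \<ominus> fst x \<noteq> \<zero> \<or> snd y \<ominus> snd x \<noteq> \<zero>"
    using assms by (auto simp: affine_plane_def minus_eq_zero_iff)
  then show ?thesis unfolding affine_comb_def using assms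
    by (intro line_mem) (auto simp: affine_plane_def)
qed

section \<open>Counting collinear triples\<close>

lemma finite_collinear_triples: "finite collinear_triples"
  unfolding collinear_triples_def by (rule finite_subset[of _ "Pow plane"]) auto

text \<open>Two points and an affine parameter determine the triple, which leaves
  \<open>q^2 * q^2 * q\<close> choices.\<close>

lemma card_collinear_triples: "card collinear_triples \<le> q ^ 5"
proof -
  let ?f = "\<lambda>((x, y), t). {x, y, affine_comb x y t}"
  let ?D = "(plane \<times> plane) \<times> carrier K"
  have "collinear_triples \<subseteq> ?f ` ?D"
  proof
    fix T assume T: "T \<in> collinear_triples"
    then obtain x y z where xyz: "T = {x, y, z}" "x \<noteq> y"
      by (auto simp: collinear_triples_def card_3_iff)
    with T have "collinear_in K {x, y, z}" by (simp add: collinear_triples_def)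
    from affine_comb_if_collinear[OF this xyz(2)] obtain t
      where "t \<in> carrier K" "z = affine_comb x y t" by blast
    with T xyz show "T \<in> ?f ` ?D"
      by (intro image_eqI[of _ _ "((x, y), t)"]) (auto simp: collinear_triples_def)
  qed
  then have "card collinear_triples \<le> card (?f ` ?D)"
    using finite_carrier by (intro card_mono) auto
  also have "\<dots> \<le> card ?D" using finite_carrier by (intro card_image_le) auto
  also have "\<dots> = q ^ 5" by (simp add: card_cartesian_product card_plane numeral_eq_Suc)
  finally show ?thesis .
qed

section \<open>Arcs and the directions seen from their points\<close>

lemma general_position_subset:
  "general_position K P \<Longrightarrow> P' \<subseteq> P \<Longrightarrow> general_position K P'"
  unfolding general_position_def by blast

text \<open>This makes \<open>I - A\<close> independent in the graph used for the containers
  whenever the arc \<open>I\<close> contains \<open>A\<close>.\<close>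

lemma general_position_slopes:
  assumes P: "general_position K P" "a \<in> P" "x \<in> P" "y \<in> P" and ne: "a \<noteq> x" "a \<noteq> y" "x \<noteq> y"
  shows "slope a x \<noteq> slope a y"
proof
  assume "slope a x = slope a y"
  with P have "collinear_in K {a, x, y}"
    by (intro collinear_if_slope_eq) (auto simp: general_position_def)
  moreover have "card {a, x, y} = 3" "{a, x, y} \<subseteq> P" using P ne by auto
  ultimately show False using P(1) unfolding general_position_def by blast
qed

text \<open>Equal slopes put \<open>a\<close> on the line through \<open>x\<close> and
  \<open>y\<close>, and that line meets an arc in at most two points. This is the multiplicity bound
  for the degree count.\<close>

lemma general_position_card_slope_eq:
  assumes A: "general_position K A" and xy: "x \<in> plane" "y \<in> plane" "x \<noteq> y"
  shows "card {a\<in>A. slope a x = slope a y} \<le> 2"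
proof (rule ccontr)
  assume "\<not> ?thesis"
  then have "3 \<le> card {a\<in>A. slope a x = slope a y}" by simp
  then obtain T where T: "T \<subseteq> {a\<in>A. slope a x = slope a y}" "card T = 3"
    by (rule obtain_subset_with_card_n)
  have "T \<subseteq> {affine_comb x y t | t. t \<in> carrier K}"
  proof
    fix a assume "a \<in> T"
    with T A xy have "collinear_in K {a, x, y}"
      by (intro collinear_if_slope_eq) (auto simp: general_position_def)
    then have "collinear_in K {x, y, a}" by (simp add: insert_commute)
    with xy show "a \<in> {affine_comb x y t | t. t \<in> carrier K}"
      using affine_comb_if_collinear by blast
  qed
  with affine_comb_line[OF xy] have "collinear_in K T" unfolding collinear_in_def by blast
  with T A show False unfolding general_position_def by blast
qed

section \<open>The parabola\<close>

lemma card_parabola: "card parabola = q"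
  unfolding parabola_def by (intro card_image) (auto simp: inj_on_def)

lemma parabola_subset: "parabola \<subseteq> plane"
  by (auto simp: parabola_def affine_plane_def)

text \<open>If the abscissa \<open>c\<close> of the third point is affinely related to
  \<open>a\<close> and \<open>b\<close>, and the squares are related with the same parameter, then
  \<open>(c \<ominus> a) \<otimes> (c \<ominus> b)\<close> vanishes. The argument works in every
  characteristic.\<close>

lemma general_position_parabola: "general_position K parabola"
  unfolding general_position_def
proof (intro conjI allI impI notI)
  show "parabola \<subseteq> plane" by (rule parabola_subset)
  fix T assume T: "T \<subseteq> parabola" "card T = 3" "collinear_in K T"
  then obtain x y z where xyz: "T = {x, y, z}" "x \<noteq> y" "x \<noteq> z" "y \<noteq> z" by (auto simp: card_3_iff)
  with T obtain a b c where abc: "a \<in> carrier K" "b \<in> carrier K" "c \<in> carrier K"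
    "x = (a, a \<otimes> a)" "y = (b, b \<otimes> b)" "z = (c, c \<otimes> c)"
    by (auto simp: parabola_def)
  from T xyz obtain t where t: "t \<in> carrier K" "z = affine_comb x y t"
    using affine_comb_if_collinear by blast
  have c: "c = a \<oplus> t \<otimes> (b \<ominus> a)" and cc: "c \<otimes> c = a \<otimes> a \<oplus> t \<otimes> (b \<otimes> b \<ominus> a \<otimes> a)"
    using arg_cong[OF t(2), of fst] arg_cong[OF t(2), of snd] unfolding abc affine_comb_def by simp_all
  have 1: "c \<ominus> a = t \<otimes> (b \<ominus> a)" unfolding c using abc t by algebra
  have "(c \<ominus> a) \<otimes> (c \<ominus> b) = (c \<otimes> c \<ominus> a \<otimes> a) \<ominus> (c \<ominus> a) \<otimes> (b \<oplus> a)"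
    using abc by algebra
  also have "\<dots> = (a \<otimes> a \<oplus> t \<otimes> (b \<otimes> b \<ominus> a \<otimes> a) \<ominus> a \<otimes> a) \<ominus> (t \<otimes> (b \<ominus> a)) \<otimes> (b \<oplus> a)"
    unfolding 1 cc ..
  also have "\<dots> = \<zero>" using abc t by algebra
  finally have "c \<ominus> a = \<zero> \<or> c \<ominus> b = \<zero>" using abc by (simp add: integral_iff)
  then have "c = a \<or> c = b" using abc by (simp add: minus_eq_zero_iff)
  with xyz abc show False by auto
qed

section \<open>The largest arc inside a set\<close>

lemma gp_number_attained:
  assumes "finite S"
  obtains P where "P \<subseteq> S" "general_position K P" "card P = gp_number K S"
proof -
  have "{card P | P. P \<subseteq> S \<and> general_position K P} = card ` {P. P \<subseteq> S \<and> general_position K P}" by blast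
  then have "finite {card P | P. P \<subseteq> S \<and> general_position K P}" using assms by simp
  moreover have "card {} \<in> {card P | P. P \<subseteq> S \<and> general_position K P}"
    by (auto simp: general_position_def intro!: exI[of _ "{}"])
  ultimately have "gp_number K S \<in> {card P | P. P \<subseteq> S \<and> general_position K P}"
    unfolding gp_number_def by (intro Max_in) auto
  then show ?thesis using that by auto
qed

lemma gp_number_ge:
  assumes "finite S" "P \<subseteq> S" "general_position K P"
  shows "card P \<le> gp_number K S"
proof -
  have "{card P | P. P \<subseteq> S \<and> general_position K P} = card ` {P. P \<subseteq> S \<and> general_position K P}" by blast
  then have "finite {card P | P. P \<subseteq> S \<and> general_position K P}" using assms by simp
  then show ?thesis unfolding gp_number_def using assms by (intro Max_ge) auto
qed

lemma gp_number_le_card: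
  assumes "finite S"
  shows "gp_number K S \<le> card S"
proof -
  obtain P where "P \<subseteq> S" "card P = gp_number K S" using gp_number_attained[OF assms] .
  with card_mono[OF assms] show ?thesis by metis
qed

lemma gp_number_mono:
  assumes "S \<subseteq> S'" "finite S'"
  shows "gp_number K S \<le> gp_number K S'"
proof -
  obtain P where P: "P \<subseteq> S" "general_position K P" "card P = gp_number K S"
    using gp_number_attained[OF finite_subset[OF assms]] .
  then show ?thesis using gp_number_ge[OF assms(2) _ P(2)] assms(1) by simp
qed

text \<open>Alteration: deleting one chosen point from each collinear triple in \<open>S\<close>
  leaves an arc.\<close>

lemma card_le_gp_number_plus_triples:
  assumes S: "S \<subseteq> plane"
  shows "card S \<le> gp_number K S + card {T\<in>collinear_triples. T \<subseteq> S}"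
proof -
  have fin: "finite S" using S finite_subset finite_affine_plane by blast
  let ?T = "{T\<in>collinear_triples. T \<subseteq> S}"
  have finT: "finite ?T" using finite_collinear_triples by simp
  define g where "g T = (SOME x. x \<in> T)" for T :: "('a \<times> 'a) set"
  have g: "g T \<in> T" if "card T = 3" for T
    unfolding g_def using that by (intro some_in_eq[THEN iffD2]) auto
  define P where "P = S - g ` ?T"
  have "general_position K P"
    unfolding general_position_def
  proof (intro conjI allI impI notI)
    show "P \<subseteq> plane" using S by (auto simp: P_def)
    fix T assume T: "T \<subseteq> P" "card T = 3" "collinear_in K T"
    then have "T \<in> ?T" using S by (auto simp: P_def collinear_triples_def)
    then have "g T \<notin> P" by (auto simp: P_def)
    with g[OF T(2)] T(1) show False by blast
  qed
  then have "card P \<le> gp_number K S" using fin by (intro gp_number_ge) (auto simp: P_def)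
  moreover have "card S \<le> card P + card (g ` ?T)"
    unfolding P_def using diff_card_le_card_Diff[of "g ` ?T" S] finT by simp
  moreover have "card (g ` ?T) \<le> card ?T" using finT by (rule card_image_le)
  ultimately show ?thesis by linarith
qed

text \<open>The abstract container lemma is applied off \<open>A\<close> with
  \<open>\<beta> = card A / (4 * (q + 1))\<close>, the degree supplied by \<open>q + 1\<close>
  directions; \<open>A\<close> is then added to every container.\<close>

lemma general_position_containers_over_subset:
  assumes A: "general_position K A" and s: "card A \<le> 4 * (q + 1)"
    and l: "(1 - real (card A) / (4 * (q + 1))) ^ l * real q ^ 2 \<le> 2 * (q + 1)"
  shows "\<exists>\<C>. finite \<C> \<and> card \<C> \<le> (q\<^sup>2 + 1) ^ l \<and>
           (\<forall>C\<in>\<C>. C \<subseteq> plane \<and> card C \<le> 2 * (q + 1) + card A + l) \<and>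
           (\<forall>I. general_position K I \<longrightarrow> A \<subseteq> I \<longrightarrow> (\<exists>C\<in>\<C>. I \<subseteq> C))"
proof -
  define D where "D = insert None (Some ` carrier K)"
  have D: "finite D" "card D = q + 1" "D \<noteq> {}"
    using finite_carrier by (auto simp: D_def card_image)
  have Ap: "A \<subseteq> plane" using A by (simp add: general_position_def)
  then have finA: "finite A" using finite_subset finite_affine_plane by blast
  define V where "V = plane - A"
  \<comment> \<open>For distinct points outside \<open>A\<close>, an edge means that the line
    through them meets \<open>A\<close>.\<close>
  define E where "E x y \<longleftrightarrow> x \<noteq> y \<and> (\<exists>a\<in>A. slope a x = slope a y)" for x y
  define \<beta> where "\<beta> = real (card A) / (4 * (q + 1))"
  have \<beta>: "\<beta> \<le> 1" using s by (simp add: \<beta>_def divide_le_eq_1)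
  have deg: "\<exists>v\<in>U. \<beta> * card U \<le> card {u\<in>U. E v u}" if U: "U \<subseteq> V" "real (2 * (q + 1)) < card U" for U
  proof -
    have finU: "finite U" using U(1) finite_subset[of U plane] by (auto simp: V_def)
    have maps: "slope a ` U \<subseteq> D" if "a \<in> A" for a
      unfolding D_def using that U(1) Ap by (intro image_subsetI slope_mem) (auto simp: V_def)
    have mult: "card {a\<in>A. slope a x = slope a y} \<le> 2" if "x \<in> U" "y \<in> U" "x \<noteq> y" for x y
      using that U(1) by (intro general_position_card_slope_eq A) (auto simp: V_def)
    \<comment> \<open>The threshold \<open>R = 2 * (q + 1)\<close> is exactly the size the averaging
      argument asks for.\<close>
    have "2 * (q + 1) < card U" using U(2) by (simp only: of_nat_less_iff)
    then have large: "2 * card D \<le> card U" using D(2) by simp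
    have "\<exists>v\<in>U. real (card A) / (4 * card D) * card U
                  \<le> card {u\<in>U. v \<noteq> u \<and> (\<exists>a\<in>A. slope a v = slope a u)}"
      using exists_large_degree[OF finA finU D(1,3) maps mult large] .
    then show ?thesis unfolding E_def \<beta>_def D(2) by simp
  qed
  have cV: "card V \<le> q\<^sup>2" unfolding V_def card_plane[symmetric] by (intro card_mono) auto
  have "real (card V) \<le> real (q\<^sup>2)" using cV by (rule of_nat_mono)
  then have "(1 - \<beta>) ^ l * card V \<le> (1 - \<beta>) ^ l * real q ^ 2"
    using \<beta> by (intro mult_left_mono) auto
  also have "\<dots> \<le> real (2 * (q + 1))" using l unfolding \<beta>_def by simp
  finally have small: "(1 - \<beta>) ^ l * card V \<le> real (2 * (q + 1))" .
  have finV: "finite V" by (simp add: V_def)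
  have "\<exists>\<C>. finite \<C> \<and> card \<C> \<le> (card V + 1) ^ l \<and>
           (\<forall>C\<in>\<C>. C \<subseteq> V \<and> card C \<le> real (2 * (q + 1)) + l) \<and>
           (\<forall>I\<subseteq>V. (\<forall>x\<in>I. \<forall>y\<in>I. \<not> E x y) \<longrightarrow> (\<exists>C\<in>\<C>. I \<subseteq> C))"
    by (rule independent_set_containers[OF \<beta> _ finV subset_refl small]) (rule deg)
  then obtain \<C> where C: "finite \<C>" "card \<C> \<le> (card V + 1) ^ l"
           "\<forall>C\<in>\<C>. C \<subseteq> V \<and> card C \<le> real (2 * (q + 1)) + l"
           "\<forall>I\<subseteq>V. (\<forall>x\<in>I. \<forall>y\<in>I. \<not> E x y) \<longrightarrow> (\<exists>C\<in>\<C>. I \<subseteq> C)"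
    by (elim exE conjE) (rule that)
  show ?thesis
  proof (intro exI[of _ "(\<union>) A ` \<C>"] conjI ballI allI impI)
    show "finite ((\<union>) A ` \<C>)" using C by simp
    have "card ((\<union>) A ` \<C>) \<le> card \<C>" using C by (intro card_image_le)
    also have "\<dots> \<le> (q\<^sup>2 + 1) ^ l"
      using power_mono[of "card V + 1" "q\<^sup>2 + 1" l] cV C(2) by linarith
    finally show "card ((\<union>) A ` \<C>) \<le> (q\<^sup>2 + 1) ^ l" .
  next
    fix C' assume "C' \<in> (\<union>) A ` \<C>"
    then obtain C where C': "C \<in> \<C>" "C' = A \<union> C" by blast
    with C(3) have *: "C \<subseteq> V" "card C \<le> real (2 * (q + 1)) + l" by auto
    then show "C' \<subseteq> plane" using Ap C' by (auto simp: V_def)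
    have "card C' \<le> card A + card C" unfolding C' by (rule card_Un_le)
    also have "card C \<le> 2 * (q + 1) + l" using *(2) by linarith
    finally show "card C' \<le> 2 * (q + 1) + card A + l" by simp
  next
    fix I assume I: "general_position K I" "A \<subseteq> I"
    have "\<not> E x y" if "x \<in> I - A" "y \<in> I - A" for x y
      using general_position_slopes[OF I(1), of _ x y] that I(2) unfolding E_def by blast
    moreover have "I - A \<subseteq> V" using I by (auto simp: V_def general_position_def)
    ultimately obtain C where "C \<in> \<C>" "I - A \<subseteq> C" using C(4) by meson
    then show "\<exists>C'\<in>(\<union>) A ` \<C>. I \<subseteq> C'" by (intro bexI[of _ "A \<union> C"]) auto
  qed
qed

text \<open>Every arc with at least \<open>s\<close> points contains an arc \<open>A\<close> of size
  \<open>s\<close>. The union of the families for all such \<open>A\<close> costs a further factor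
  of at most \<open>(q^2 + 1) ^ s\<close>.\<close>

lemma general_position_containers:
  assumes s: "s \<le> 4 * (q + 1)"
    and l: "(1 - real s / (4 * (q + 1))) ^ l * real q ^ 2 \<le> 2 * (q + 1)"
  shows "\<exists>\<C>. finite \<C> \<and> card \<C> \<le> (q\<^sup>2 + 1) ^ (s + l) \<and>
           (\<forall>C\<in>\<C>. C \<subseteq> plane \<and> card C \<le> 2 * (q + 1) + s + l) \<and>
           (\<forall>I. general_position K I \<longrightarrow> s \<le> card I \<longrightarrow> (\<exists>C\<in>\<C>. I \<subseteq> C))"
proof -
  define \<A> where "\<A> = {A. A \<subseteq> plane \<and> card A = s}"
  have finA: "finite \<A>" by (rule finite_subset[of _ "Pow plane"]) (auto simp: \<A>_def)
  have "card \<A> = (q\<^sup>2 choose s)" unfolding \<A>_def card_plane[symmetric] by (rule n_subsets) simp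
  also have "\<dots> \<le> (q\<^sup>2 + 1) ^ s"
  proof (cases "s \<le> q\<^sup>2")
    case True
    then have "(q\<^sup>2 choose s) \<le> (q\<^sup>2) ^ s" by (rule binomial_le_pow)
    also have "\<dots> \<le> (q\<^sup>2 + 1) ^ s" by (intro power_mono) auto
    finally show ?thesis .
  qed (simp add: binomial_eq_0)
  finally have cA: "card \<A> \<le> (q\<^sup>2 + 1) ^ s" .
  have "\<forall>A\<in>{A\<in>\<A>. general_position K A}. \<exists>\<C>. finite \<C> \<and> card \<C> \<le> (q\<^sup>2 + 1) ^ l \<and>
           (\<forall>C\<in>\<C>. C \<subseteq> plane \<and> card C \<le> 2 * (q + 1) + s + l) \<and>
           (\<forall>I. general_position K I \<longrightarrow> A \<subseteq> I \<longrightarrow> (\<exists>C\<in>\<C>. I \<subseteq> C))"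
    using general_position_containers_over_subset s l unfolding \<A>_def by blast
  then obtain F where F: "\<forall>A\<in>{A\<in>\<A>. general_position K A}. finite (F A) \<and> card (F A) \<le> (q\<^sup>2 + 1) ^ l \<and>
           (\<forall>C\<in>F A. C \<subseteq> plane \<and> card C \<le> 2 * (q + 1) + s + l) \<and>
           (\<forall>I. general_position K I \<longrightarrow> A \<subseteq> I \<longrightarrow> (\<exists>C\<in>F A. I \<subseteq> C))"
    by (rule bchoice[THEN exE])
  let ?B = "{A\<in>\<A>. general_position K A}"
  show ?thesis
  proof (intro exI[of _ "\<Union>(F ` ?B)"] conjI)
    show "finite (\<Union>(F ` ?B))" using finA F by auto
    have "card (\<Union>(F ` ?B)) \<le> (\<Sum>A\<in>?B. card (F A))" using finA by (intro card_UN_le) simp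
    also have "\<dots> \<le> (\<Sum>A\<in>?B. (q\<^sup>2 + 1) ^ l)" using F by (intro sum_mono) auto
    also have "\<dots> = card ?B * (q\<^sup>2 + 1) ^ l" by simp
    also have "card ?B \<le> card \<A>" using finA by (intro card_mono) auto
    also note cA
    finally show "card (\<Union>(F ` ?B)) \<le> (q\<^sup>2 + 1) ^ (s + l)" by (simp add: power_add)
    show "\<forall>C\<in>\<Union>(F ` ?B). C \<subseteq> plane \<and> card C \<le> 2 * (q + 1) + s + l" using F by blast
    show "\<forall>I. general_position K I \<longrightarrow> s \<le> card I \<longrightarrow> (\<exists>C\<in>\<Union>(F ` ?B). I \<subseteq> C)"
    proof (intro allI impI)
      fix I assume I: "general_position K I" "s \<le> card I"
      then obtain A where A: "A \<subseteq> I" "card A = s" by (meson obtain_subset_with_card_n)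
      from general_position_subset[OF I(1) A(1)] A(2) have B: "A \<in> ?B"
        by (auto simp: \<A>_def general_position_def)
      from bspec[OF F B] I(1) A(1) obtain C where "C \<in> F A" "I \<subseteq> C" by meson
      with B show "\<exists>C\<in>\<Union>(F ` ?B). I \<subseteq> C" by (intro bexI[of _ C]) auto
    qed
  qed
qed

end

section \<open>Tail bounds\<close>

context finite_plane
begin

lemma prob_alpha:
  "measure_pmf.prob (alpha_pmf K p) {\<alpha>. Q \<alpha>} =
     measure_pmf.prob (random_subset plane p) {S. Q (gp_number K S)}"
  by (simp add: alpha_pmf_def vimage_def)

text \<open>The random set is supported on subsets of the plane, so comparing the events there
  suffices.\<close>

lemma prob_alpha_le:
  assumes "\<And>S. S \<subseteq> plane \<Longrightarrow> Q (gp_number K S) \<Longrightarrow> S \<in> X"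
  shows "measure_pmf.prob (alpha_pmf K p) {\<alpha>. Q \<alpha>} \<le> measure_pmf.prob (random_subset plane p) X"
proof -
  let ?M = "random_subset plane p"
  have "measure_pmf.prob ?M {S. Q (gp_number K S)} = measure_pmf.prob ?M ({S. Q (gp_number K S)} \<inter> set_pmf ?M)"
    by (simp add: measure_Int_set_pmf)
  also have "\<dots> \<le> measure_pmf.prob ?M X"
    using assms finite_set_random_subset(2)[OF finite_affine_plane] by (intro measure_pmf.finite_measure_mono) auto
  finally show ?thesis unfolding prob_alpha .
qed

lemma finite_subset_plane: "S \<subseteq> plane \<Longrightarrow> finite S"
  using finite_subset finite_affine_plane by blast

context
  fixes p :: real
  assumes p: "0 \<le> p" "p \<le> 1"
begin

text \<open>Union bound: a largest arc of \<open>S\<close> with at least \<open>t\<close> points has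
  at least \<open>s\<close> points, hence lies in some container \<open>C\<close>, and then
  \<open>S \<inter> C\<close> has at least \<open>t\<close> points.\<close>

lemma alpha_upper_tail_container:
  assumes s: "s \<le> 4 * (q + 1)" "real s \<le> t"
    and l: "(1 - real s / (4 * (q + 1))) ^ l * real q ^ 2 \<le> 2 * (q + 1)"
  shows "measure_pmf.prob (alpha_pmf K p) {\<alpha>. t \<le> real \<alpha>}
           \<le> real ((q\<^sup>2 + 1) ^ (s + l)) * exp (2 * p * (2 * (q + 1) + s + l) - t)"
proof -
  let ?M = "random_subset plane p"
  obtain \<C> where C: "finite \<C>" "card \<C> \<le> (q\<^sup>2 + 1) ^ (s + l)"
      "\<forall>C\<in>\<C>. C \<subseteq> plane \<and> card C \<le> 2 * (q + 1) + s + l"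
      "\<forall>I. general_position K I \<longrightarrow> s \<le> card I \<longrightarrow> (\<exists>C\<in>\<C>. I \<subseteq> C)"
    using general_position_containers[OF s(1) l] by (elim exE conjE) (rule that)
  have "measure_pmf.prob (alpha_pmf K p) {\<alpha>. t \<le> real \<alpha>}
      \<le> measure_pmf.prob ?M (\<Union>C\<in>\<C>. {S. t \<le> real (card (S \<inter> C))})"
  proof (rule prob_alpha_le)
    fix S assume S: "S \<subseteq> plane" "t \<le> real (gp_number K S)"
    obtain P where P: "P \<subseteq> S" "general_position K P" "card P = gp_number K S"
      using gp_number_attained[OF finite_subset_plane[OF S(1)]] .
    have "s \<le> card P" using S s P by linarith
    with C(4) P(2) obtain C where c: "C \<in> \<C>" "P \<subseteq> C" by meson
    have "card P \<le> card (S \<inter> C)"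
      using P(1) c finite_subset_plane[OF S(1)] by (intro card_mono) auto
    then have "t \<le> real (card (S \<inter> C))" using S(2) P(3) by linarith
    with c(1) show "S \<in> (\<Union>C\<in>\<C>. {S. t \<le> real (card (S \<inter> C))})" by blast
  qed
  also have "\<dots> \<le> (\<Sum>C\<in>\<C>. measure_pmf.prob ?M {S. t \<le> real (card (S \<inter> C))})"
    using C(1) by (intro measure_UNION_le) auto
  also have "\<dots> \<le> (\<Sum>C\<in>\<C>. exp (2 * p * (2 * (q + 1) + s + l) - t))"
  proof (intro sum_mono)
    fix C assume "C \<in> \<C>"
    with C(3) have c: "C \<subseteq> plane" "card C \<le> 2 * (q + 1) + s + l" by auto
    have "measure_pmf.prob ?M {S. t \<le> real (card (S \<inter> C))} \<le> exp (2 * p * card C - t)"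
      using c p by (intro random_subset_upper_tail) auto
    also have "\<dots> \<le> exp (2 * p * (2 * (q + 1) + s + l) - t)"
    proof -
      have "2 * p * real (card C) \<le> 2 * p * real (2 * (q + 1) + s + l)"
        using c(2) p by (intro mult_left_mono of_nat_mono) auto
      then show ?thesis by simp
    qed
    finally show "measure_pmf.prob ?M {S. t \<le> real (card (S \<inter> C))} \<le> exp (2 * p * (2 * (q + 1) + s + l) - t)" .
  qed
  also have "\<dots> = real (card \<C>) * exp (2 * p * (2 * (q + 1) + s + l) - t)" by simp
  also have "\<dots> \<le> real ((q\<^sup>2 + 1) ^ (s + l)) * exp (2 * p * (2 * (q + 1) + s + l) - t)"
    by (intro mult_right_mono of_nat_mono C(2)) auto
  finally show ?thesis .
qed

lemma alpha_upper_tail_card: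
  "measure_pmf.prob (alpha_pmf K p) {\<alpha>. t \<le> real \<alpha>} \<le> exp (2 * p * real q ^ 2 - t)"
proof -
  have "measure_pmf.prob (alpha_pmf K p) {\<alpha>. t \<le> real \<alpha>}
      \<le> measure_pmf.prob (random_subset plane p) {S. t \<le> real (card (S \<inter> plane))}"
  proof (rule prob_alpha_le)
    fix S assume S: "S \<subseteq> plane" "t \<le> real (gp_number K S)"
    have "gp_number K S \<le> card (S \<inter> plane)"
      using S(1) gp_number_le_card[OF finite_subset_plane[OF S(1)]] by (simp add: Int_absorb2)
    with S(2) show "S \<in> {S. t \<le> real (card (S \<inter> plane))}" by simp
  qed
  also have "\<dots> \<le> exp (2 * p * card plane - t)" using p by (intro random_subset_upper_tail) auto
  finally show ?thesis by (simp add: card_plane)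
qed

lemma alpha_lower_tail_parabola:
  "measure_pmf.prob (alpha_pmf K p) {\<alpha>. real \<alpha> \<le> t} \<le> exp (t - p * q / 2)"
proof -
  have "measure_pmf.prob (alpha_pmf K p) {\<alpha>. real \<alpha> \<le> t}
      \<le> measure_pmf.prob (random_subset plane p) {S. real (card (S \<inter> parabola)) \<le> t}"
  proof (rule prob_alpha_le)
    fix S assume S: "S \<subseteq> plane" "real (gp_number K S) \<le> t"
    have "general_position K (S \<inter> parabola)"
      using general_position_subset[OF general_position_parabola] by auto
    then have "card (S \<inter> parabola) \<le> gp_number K S"
      using finite_subset_plane[OF S(1)] by (intro gp_number_ge) auto
    with S(2) show "S \<in> {S. real (card (S \<inter> parabola)) \<le> t}" by simp
  qed
  also have "\<dots> \<le> exp (t - p * card parabola / 2)"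
    using p parabola_subset by (intro random_subset_lower_tail) auto
  finally show ?thesis by (simp add: card_parabola)
qed

text \<open>The number \<open>r\<close> is the allowance for deletions: a small
  \<open>gp_number\<close> forces either at most \<open>t + r\<close> random points or at least
  \<open>r\<close> collinear triples among them.\<close>

lemma alpha_lower_tail_deletion:
  assumes r: "0 < r"
  shows "measure_pmf.prob (alpha_pmf K p) {\<alpha>. real \<alpha> \<le> t}
           \<le> exp (t + r - p * real q ^ 2 / 2) + real q ^ 5 * p ^ 3 / r"
proof -
  let ?M = "random_subset plane p"
  let ?X = "{S. real (card (S \<inter> plane)) \<le> t + r}"
  let ?Y = "{S. r \<le> real (card {T\<in>collinear_triples. T \<subseteq> S})}"
  have "measure_pmf.prob (alpha_pmf K p) {\<alpha>. real \<alpha> \<le> t} \<le> measure_pmf.prob ?M (?X \<union> ?Y)"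
  proof (rule prob_alpha_le)
    fix S assume S: "S \<subseteq> plane" "real (gp_number K S) \<le> t"
    have "real (card S) \<le> real (gp_number K S) + real (card {T\<in>collinear_triples. T \<subseteq> S})"
      using card_le_gp_number_plus_triples[OF S(1)] by linarith
    with S(2) have "real (card S) \<le> t + r \<or> r \<le> real (card {T\<in>collinear_triples. T \<subseteq> S})" by linarith
    then show "S \<in> ?X \<union> ?Y" using S(1) by (auto simp: Int_absorb2)
  qed
  also have "\<dots> \<le> measure_pmf.prob ?M ?X + measure_pmf.prob ?M ?Y"
    by (intro measure_Un_le) auto
  also have "measure_pmf.prob ?M ?X \<le> exp (t + r - p * card plane / 2)"
    using p by (intro random_subset_lower_tail) auto
  also have "measure_pmf.prob ?M ?Y \<le> card collinear_triples * p ^ 3 / r"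
    using p r by (intro random_subset_few_members) (auto simp: collinear_triples_def)
  also have "\<dots> \<le> real (q ^ 5) * p ^ 3 / r"
    using p r by (intro divide_right_mono mult_right_mono of_nat_mono card_collinear_triples) auto
  finally show ?thesis by (simp add: card_plane)
qed

text \<open>The coupling applies to the increasing event that the arc number exceeds
  \<open>t\<close>; taking complements reverses the inequality.\<close>

lemma alpha_lower_tail_mono:
  assumes "0 \<le> p'" "p' \<le> p"
  shows "measure_pmf.prob (alpha_pmf K p) {\<alpha>. real \<alpha> \<le> t} \<le> measure_pmf.prob (alpha_pmf K p') {\<alpha>. real \<alpha> \<le> t}"
proof -
  have c: "measure_pmf.prob M {x. Q x} = 1 - measure_pmf.prob M {x. \<not> Q x}" for M :: "'c pmf" and Q
    using measure_pmf.prob_compl[of "{x. \<not> Q x}" M] by (simp add: Compl_eq_Diff_UNIV[symmetric] Collect_neg_eq[symmetric])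
  have "measure_pmf.prob (random_subset plane p') {S. \<not> real (gp_number K S) \<le> t}
      \<le> measure_pmf.prob (random_subset plane p) {S. \<not> real (gp_number K S) \<le> t}"
  proof (rule random_subset_mono)
    fix S S' assume S: "S \<subseteq> S'" "S' \<subseteq> plane" "\<not> real (gp_number K S) \<le> t"
    with gp_number_mono[OF S(1) finite_subset_plane[OF S(2)]] show "\<not> real (gp_number K S') \<le> t" by linarith
  qed (use assms p in auto)
  then show ?thesis unfolding prob_alpha by (subst (1 2) c) simp
qed

end

end

section \<open>Size conditions on the order of the field\<close>

definition large_order :: "nat \<Rightarrow> bool" where
  "large_order q \<longleftrightarrow> 25 \<le> ln (real q) \<and> (ln (real q))\<^sup>2 \<le> sqrt (real q) \<and> ln (real q ^ 2 + 1) \<le> 3 * ln (real q) \<and>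
     (\<exists>s l. s \<le> 4 * (q + 1) \<and> real s \<le> 2 * sqrt (real q) \<and>
        (1 - real s / (4 * (q + 1))) ^ l * real q ^ 2 \<le> 2 * (q + 1) \<and>
        real (s + l) \<le> 6 * (sqrt (real q) * ln (real q)) \<and> 2 * (q + 1) + s + l \<le> 3 * q)"

text \<open>With \<open>s\<close> near \<open>\<surd>q\<close> and \<open>l\<close> near
  \<open>4 \<surd>q ln q\<close>, the estimate \<open>1 - y \<le> exp (- y)\<close> brings the power
  \<open>(1 - s / (4 * (q + 1))) ^ l\<close> down to at most \<open>1/q\<close>, so the plane
  shrinks below \<open>2 * (q + 1)\<close>.\<close>

lemma eventually_large_order: "eventually large_order at_top"
proof -
  have 1: "\<forall>\<^sub>F q::nat in at_top. 25 \<le> ln (real q)" by real_asymp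
  have 2: "\<forall>\<^sub>F q::nat in at_top. (ln (real q))\<^sup>2 \<le> sqrt (real q)" by real_asymp
  have 3: "\<forall>\<^sub>F q::nat in at_top. ln (real q ^ 2 + 1) \<le> 3 * ln (real q)" by real_asymp
  have 4: "\<forall>\<^sub>F q::nat in at_top. sqrt (real q) + 1 \<le> 4 * (real q + 1)" by real_asymp
  have 5: "\<forall>\<^sub>F q::nat in at_top. sqrt (real q) + 1 \<le> 2 * sqrt (real q)" by real_asymp
  have 6: "\<forall>\<^sub>F q::nat in at_top. sqrt (real q) + 1 + (4 * (real q + 1) * ln (real q) / sqrt (real q) + 1)
             \<le> 6 * (sqrt (real q) * ln (real q))" by real_asymp
  have 7: "\<forall>\<^sub>F q::nat in at_top. 2 * (real q + 1) + 6 * (sqrt (real q) * ln (real q)) \<le> 3 * real q" by real_asymp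
  have 8: "\<forall>\<^sub>F q::nat in at_top. 1 \<le> q" by (rule eventually_ge_at_top)
  show ?thesis
    using 1 2 3 4 5 6 7 8
  proof eventually_elim
    case (elim q)
    define x where "x = real q"
    \<comment> \<open>\<open>l\<close> is the least integer with
      \<open>l * sqrt x \<ge> 4 * (x + 1) * ln x\<close>, which makes the exponent
      \<open>s * l / (4 * (x + 1))\<close> at least \<open>ln x\<close>.\<close>
    define s where "s = nat \<lceil>sqrt x\<rceil>"
    define l where "l = nat \<lceil>4 * (x + 1) * ln x / sqrt x\<rceil>"
    have x: "0 < x" "0 < sqrt x" "0 \<le> ln x" using elim by (auto simp: x_def)
    have s: "sqrt x \<le> real s" "real s \<le> sqrt x + 1" using x by (auto simp: s_def)
    have l: "4 * (x + 1) * ln x / sqrt x \<le> real l" "real l \<le> 4 * (x + 1) * ln x / sqrt x + 1"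
      using x by (auto simp: l_def)
    have s4: "real s \<le> 4 * (x + 1)" using s elim by (simp add: x_def)
    have "4 * (x + 1) * ln x = sqrt x * (4 * (x + 1) * ln x / sqrt x)" using x by simp
    also have "\<dots> \<le> real s * real l" using s l x by (intro mult_mono) auto
    finally have "ln x \<le> real s * real l / (4 * (x + 1))" using x by (simp add: field_simps)
    then have "ln x \<le> real l * (real s / (4 * (x + 1)))" by (simp add: mult_ac)
    have "(1 - real s / (4 * (x + 1))) ^ l \<le> exp (- (real s / (4 * (x + 1)))) ^ l"
    proof (rule power_mono)
      show "1 - real s / (4 * (x + 1)) \<le> exp (- (real s / (4 * (x + 1))))"
        using exp_ge_add_one_self[of "- (real s / (4 * (x + 1)))"] by simp
      show "0 \<le> 1 - real s / (4 * (x + 1))" using s4 x by simp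
    qed
    also have "\<dots> = exp (- (real l * (real s / (4 * (x + 1)))))" by (simp flip: exp_of_nat_mult)
    also have "\<dots> \<le> exp (- ln x)" using \<open>ln x \<le> real l * (real s / (4 * (x + 1)))\<close> by simp
    also have "\<dots> = 1 / x" using x by (simp add: exp_minus inverse_eq_divide)
    finally have "(1 - real s / (4 * (x + 1))) ^ l * x ^ 2 \<le> 1 / x * x ^ 2" using x by (intro mult_right_mono) auto
    also have "\<dots> = x" using x by (simp add: power2_eq_square)
    finally have pw: "(1 - real s / (4 * (x + 1))) ^ l * x ^ 2 \<le> 2 * (x + 1)" using x by simp
    have sl: "real (s + l) \<le> 6 * (sqrt x * ln x)" using s l elim by (simp add: x_def)
    then have "real (2 * (q + 1) + s + l) \<le> real (3 * q)" using elim by (simp add: x_def)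
    then have "2 * (q + 1) + s + l \<le> 3 * q" by (simp only: of_nat_le_iff)
    moreover have "s \<le> 4 * (q + 1)" using s4 unfolding x_def by (simp flip: of_nat_le_iff[where 'a = real])
    moreover have "real s \<le> 2 * sqrt x" using s(2) elim(5) unfolding x_def by linarith
    ultimately show ?case unfolding large_order_def using elim pw sl
      by (intro conjI exI[of _ s] exI[of _ l]) (auto simp: x_def add_ac)
  qed
qed

section \<open>Tail bounds in the three ranges of \<open>p\<close>\<close>

context finite_plane
begin

context
  fixes p L :: real
  assumes p: "0 \<le> p" "p \<le> 1" and large: "large_order q" and L_def: "L = ln (real q)"
begin

text \<open>The logarithm of the number of containers is at most \<open>6 * sqrt q * L\<close> times
  \<open>3 * L\<close>, whence 18; containers of at most \<open>3 * q\<close> points turn the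
  Chernoff term into \<open>6 * p * q\<close>.\<close>

lemma alpha_upper_tail:
  assumes t: "2 * sqrt q \<le> t"
  shows "measure_pmf.prob (alpha_pmf K p) {\<alpha>. t \<le> real \<alpha>} \<le> exp (18 * (sqrt q * L\<^sup>2) + 6 * (p * q) - t)"
proof -
  from large obtain s l where sl: "s \<le> 4 * (q + 1)" "real s \<le> 2 * sqrt q"
      "(1 - real s / (4 * (q + 1))) ^ l * real q ^ 2 \<le> 2 * (q + 1)"
      "real (s + l) \<le> 6 * (sqrt q * L)" "2 * (q + 1) + s + l \<le> 3 * q"
    unfolding large_order_def L_def by blast
  have L: "25 \<le> L" "ln (real q ^ 2 + 1) \<le> 3 * L" using large by (auto simp: large_order_def L_def)
  have "measure_pmf.prob (alpha_pmf K p) {\<alpha>. t \<le> real \<alpha>}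
           \<le> real ((q\<^sup>2 + 1) ^ (s + l)) * exp (2 * p * (2 * (q + 1) + s + l) - t)"
    using sl t p by (intro alpha_upper_tail_container) auto
  also have "real ((q\<^sup>2 + 1) ^ (s + l)) = exp (ln (real q ^ 2 + 1)) ^ (s + l)"
    by (simp add: add_pos_nonneg add_nonneg_pos add.commute)
  also have "\<dots> = exp (real (s + l) * ln (real q ^ 2 + 1))" by (simp flip: exp_of_nat_mult)
  also have "\<dots> \<le> exp (6 * (sqrt q * L) * (3 * L))"
    using sl L by (subst exp_le_cancel_iff, intro mult_mono) auto
  also have "exp (2 * p * (2 * (q + 1) + s + l) - t) \<le> exp (2 * p * real (3 * q) - t)"
    using sl(5) p mult_left_mono[OF of_nat_mono[OF sl(5)], of "2 * p"] by simp
  also have "exp (6 * (sqrt q * L) * (3 * L)) * exp (2 * p * real (3 * q) - t)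
      = exp (18 * (sqrt q * L\<^sup>2) + 6 * (p * q) - t)"
    by (simp flip: exp_add add: power2_eq_square algebra_simps)
  finally show ?thesis by simp
qed

text \<open>Deletion with \<open>t = r = p * q^2 / 8\<close>: the exponent becomes
  \<open>- p * q^2 / 4\<close>, and the triples contribute \<open>8 * q^3 * p^2\<close>, which the
  upper limit on \<open>p\<close> keeps below \<open>8 / L^2\<close>.\<close>

lemma alpha_lower_tail_sparse:
  assumes "L / real q ^ 2 \<le> p" "p \<le> 1 / (q * sqrt q * L)"
  shows "measure_pmf.prob (alpha_pmf K p) {\<alpha>. real \<alpha> \<le> p * real q ^ 2 / 8} \<le> exp (- L / 4) + 8 / L\<^sup>2"
proof -
  define x where "x = real q"
  have L: "25 \<le> L" using large by (auto simp: large_order_def L_def)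
  have x: "0 < x" using q_ge_2 by (simp add: x_def)
  have pL: "L \<le> p * x ^ 2" using assms(1) x by (simp add: x_def field_simps)
  have p0: "0 < p" using pL L p x by (cases "p = 0") auto
  have "0 < x * sqrt x * L" using x L by simp
  then have "p * (x * sqrt x * L) \<le> 1" using assms(2) by (simp add: x_def pos_le_divide_eq)
  then have "(p * (x * sqrt x * L))\<^sup>2 \<le> 1" using p x L by (simp add: abs_square_le_1)
  then have tr: "x ^ 3 * p\<^sup>2 * L\<^sup>2 \<le> 1"
    using x by (simp add: power_mult_distrib power2_eq_square power3_eq_cube mult_ac)
  have "measure_pmf.prob (alpha_pmf K p) {\<alpha>. real \<alpha> \<le> p * real q ^ 2 / 8}
    \<le> exp (p * x ^ 2 / 8 + p * x ^ 2 / 8 - p * x ^ 2 / 2) + x ^ 5 * p ^ 3 / (p * x ^ 2 / 8)"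
    unfolding x_def using p p0 q_ge_2 by (intro alpha_lower_tail_deletion) auto
  also have "exp (p * x ^ 2 / 8 + p * x ^ 2 / 8 - p * x ^ 2 / 2) \<le> exp (- L / 4)" using pL by simp
  also have "x ^ 5 * p ^ 3 / (p * x ^ 2 / 8) = 8 * (x ^ 3 * p\<^sup>2)"
    using x p0 by (simp add: field_simps power2_eq_square power3_eq_cube eval_nat_numeral)
  also have "\<dots> \<le> 8 / L\<^sup>2" using tr L by (simp add: field_simps)
  finally show ?thesis by simp
qed

lemma alpha_upper_tail_sparse:
  assumes "L / real q ^ 2 \<le> p"
  shows "measure_pmf.prob (alpha_pmf K p) {\<alpha>. 40 * (p * real q ^ 2) \<le> real \<alpha>} \<le> exp (- L)"
proof -
  have L: "25 \<le> L" using large by (auto simp: large_order_def L_def)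
  have "L \<le> p * real q ^ 2" using assms q_ge_2 by (simp add: field_simps)
  then have "2 * p * real q ^ 2 - 40 * (p * real q ^ 2) \<le> - L" using L by linarith
  then show ?thesis
    using alpha_upper_tail_card[OF p, of "40 * (p * real q ^ 2)"] by (meson exp_le_cancel_iff order.trans)
qed

text \<open>The constant 25 is 18 + 6 + 1: the two coefficients of \<open>alpha_upper_tail\<close>
  and the surplus that yields the decay \<open>exp (- sqrt q)\<close>.\<close>

lemma sqrt_bounds: "0 < sqrt q" "sqrt q \<le> sqrt q * L\<^sup>2" "25 * (sqrt q * L\<^sup>2) \<le> sqrt q * L ^ 3"
proof -
  have L: "25 \<le> L" using large by (auto simp: large_order_def L_def)
  show s: "0 < sqrt q" using q_ge_2 by simp
  have "1 \<le> L\<^sup>2" using L by (intro one_le_power) auto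
  then show "sqrt q \<le> sqrt q * L\<^sup>2" using s by simp
  have "25 * (sqrt q * L\<^sup>2) \<le> L * (sqrt q * L\<^sup>2)" using L s by (intro mult_right_mono) auto
  then show "25 * (sqrt q * L\<^sup>2) \<le> sqrt q * L ^ 3" by (simp add: eval_nat_numeral mult_ac)
qed

lemma alpha_upper_tail_middle:
  assumes "p \<le> L\<^sup>2 / sqrt q"
  shows "measure_pmf.prob (alpha_pmf K p) {\<alpha>. sqrt q * L ^ 3 \<le> real \<alpha>} \<le> exp (- sqrt q)"
proof -
  have L: "25 \<le> L" using large by (auto simp: large_order_def L_def)
  have "p * q \<le> L\<^sup>2 / sqrt q * q" using assms by (intro mult_right_mono) auto
  also have "\<dots> = sqrt q * L\<^sup>2" using sqrt_bounds(1) by (simp add: field_simps)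
  finally have "18 * (sqrt q * L\<^sup>2) + 6 * (p * q) - sqrt q * L ^ 3 \<le> - sqrt q" using sqrt_bounds by linarith
  moreover have "2 * sqrt q \<le> sqrt q * L ^ 3" using sqrt_bounds by linarith
  ultimately show ?thesis
    using alpha_upper_tail[of "sqrt q * L ^ 3"] by (meson exp_le_cancel_iff order.trans)
qed

text \<open>In this range \<open>p * q\<close> dominates the container term
  \<open>sqrt q * L^2\<close>, and the parabola supplies the matching lower bound.\<close>

lemma alpha_tails_dense:
  assumes "L\<^sup>2 / sqrt q \<le> p"
  shows "measure_pmf.prob (alpha_pmf K p) {\<alpha>. 40 * (p * q) \<le> real \<alpha>} \<le> exp (- sqrt q)"
    and "measure_pmf.prob (alpha_pmf K p) {\<alpha>. real \<alpha> \<le> p * q / 8} \<le> exp (- sqrt q / 4)"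
proof -
  have "sqrt q * L\<^sup>2 = L\<^sup>2 / sqrt q * q" using sqrt_bounds(1) by (simp add: field_simps)
  also have "\<dots> \<le> p * q" using assms by (intro mult_right_mono) auto
  finally have pq: "sqrt q * L\<^sup>2 \<le> p * q" .
  have "18 * (sqrt q * L\<^sup>2) + 6 * (p * q) - 40 * (p * q) \<le> - sqrt q" "2 * sqrt q \<le> 40 * (p * q)"
    using sqrt_bounds pq by linarith+
  then show "measure_pmf.prob (alpha_pmf K p) {\<alpha>. 40 * (p * q) \<le> real \<alpha>} \<le> exp (- sqrt q)"
    using alpha_upper_tail[of "40 * (p * q)"] by (meson exp_le_cancel_iff order.trans)
  have "p * q / 8 - p * q / 2 \<le> - sqrt q / 4" using sqrt_bounds pq by linarith
  then show "measure_pmf.prob (alpha_pmf K p) {\<alpha>. real \<alpha> \<le> p * q / 8} \<le> exp (- sqrt q / 4)"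
    using alpha_lower_tail_parabola[OF p, of "p * q / 8"] by (meson exp_le_cancel_iff order.trans)
qed

end

text \<open>Monotonicity reduces to the top \<open>p'\<close> of the sparse range, where
  \<open>p' * q^2 / 8\<close> equals \<open>sqrt q / (8 * L)\<close>.\<close>

lemma alpha_lower_tail_middle:
  fixes p L :: real
  assumes p: "0 \<le> p" "p \<le> 1" and large: "large_order q" and L_def: "L = ln (real q)"
    and p0: "1 / (q * sqrt q * L) \<le> p"
  shows "measure_pmf.prob (alpha_pmf K p) {\<alpha>. real \<alpha> \<le> sqrt q / L ^ 3} \<le> exp (- L / 4) + 8 / L\<^sup>2"
proof -
  define p' where "p' = 1 / (q * sqrt q * L)"
  have L: "25 \<le> L" "L\<^sup>2 \<le> sqrt q" using large by (auto simp: large_order_def L_def)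
  have q: "0 < real q" "0 < sqrt q" using q_ge_2 by auto
  have p': "0 \<le> p'" "p' \<le> p" using L q p0 by (auto simp: p'_def)
  have pq: "p' * real q ^ 2 = sqrt q / L"
    unfolding p'_def power2_eq_square using q L by (simp add: field_simps)
  \<comment> \<open>This places \<open>p'\<close> above the lower end of the sparse range.\<close>
  have "L * L \<le> sqrt q" using L by (simp add: power2_eq_square)
  then have "L \<le> sqrt q / L" using L by (simp add: field_simps)
  then have pL: "L / real q ^ 2 \<le> p'" unfolding pq[symmetric] using q by (simp add: field_simps)
  have "8 * L \<le> L ^ 3"
  proof -
    have "8 \<le> 25 * (25 :: real)" by simp
    also have "\<dots> \<le> L * L" using L by (intro mult_mono) auto
    finally have "8 * L \<le> (L * L) * L" using L by (intro mult_right_mono) auto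
    then show ?thesis by (simp add: power3_eq_cube)
  qed
  then have le: "sqrt q / L ^ 3 \<le> p' * real q ^ 2 / 8"
    unfolding pq using L q by (simp add: frac_le)
  have "measure_pmf.prob (alpha_pmf K p) {\<alpha>. real \<alpha> \<le> sqrt q / L ^ 3}
     \<le> measure_pmf.prob (alpha_pmf K p') {\<alpha>. real \<alpha> \<le> sqrt q / L ^ 3}"
    by (rule alpha_lower_tail_mono[OF p p'])
  also have "\<dots> \<le> measure_pmf.prob (alpha_pmf K p') {\<alpha>. real \<alpha> \<le> p' * real q ^ 2 / 8}"
    using order.trans[OF _ le] by (intro measure_pmf.finite_measure_mono subsetI CollectI) auto
  also have "\<dots> \<le> exp (- L / 4) + 8 / L\<^sup>2"
    using p' p large pL L_def unfolding p'_def by (intro alpha_lower_tail_sparse) auto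
  finally show ?thesis .
qed

text \<open>Union bound over six failures, a lower and an upper one for each range. The error
  depends on \<open>q\<close> alone, which makes the limit uniform in the field and in
  \<open>p\<close>.\<close>

lemma prob_alpha_good:
  fixes p L :: real
  assumes p: "0 \<le> p" "p \<le> 1" and large: "large_order q" and L_def: "L = ln (real q)"
  shows "1 - (2 * exp (- L / 4) + 16 / L\<^sup>2 + exp (- L) + 2 * exp (- sqrt q) + exp (- sqrt q / 4))
    \<le> measure_pmf.prob (alpha_pmf K p) {\<alpha>.
        (L / real q ^ 2 \<le> p \<and> p \<le> 1 / (q * sqrt q * L) \<longrightarrow>
           p * real q ^ 2 / 8 \<le> real \<alpha> \<and> real \<alpha> \<le> 40 * (p * real q ^ 2)) \<and>
        (1 / (q * sqrt q * L) \<le> p \<and> p \<le> L\<^sup>2 / sqrt q \<longrightarrow>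
           sqrt q / L ^ 3 \<le> real \<alpha> \<and> real \<alpha> \<le> sqrt q * L ^ 3) \<and>
        (L\<^sup>2 / sqrt q \<le> p \<longrightarrow> p * q / 8 \<le> real \<alpha> \<and> real \<alpha> \<le> 40 * (p * q))}"
    (is "1 - ?e \<le> measure_pmf.prob ?M ?good")
proof -
  define R where "R i \<longleftrightarrow> (if i = 0 then L / real q ^ 2 \<le> p \<and> p \<le> 1 / (q * sqrt q * L)
    else if i = 1 then 1 / (q * sqrt q * L) \<le> p \<and> p \<le> L\<^sup>2 / sqrt q else L\<^sup>2 / sqrt q \<le> p)" for i :: nat
  \<comment> \<open>\<open>p\<close> is deterministic: outside its range a failure event is empty,
    inside it the tail bound applies.\<close>
  have restrict: "measure_pmf.prob ?M {\<alpha>. R i \<and> Q \<alpha>} \<le> e"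
    if "R i \<Longrightarrow> measure_pmf.prob ?M {\<alpha>. Q \<alpha>} \<le> e" "0 \<le> e" for i Q e
    using that by (cases "R i") auto
  note tails = alpha_lower_tail_sparse[OF p large L_def] alpha_upper_tail_sparse[OF p large L_def]
    alpha_lower_tail_middle[OF p large L_def] alpha_upper_tail_middle[OF p large L_def] alpha_tails_dense[OF p large L_def]
  let ?B1 = "{\<alpha>. R 0 \<and> real \<alpha> \<le> p * real q ^ 2 / 8}" let ?B2 = "{\<alpha>. R 0 \<and> 40 * (p * real q ^ 2) \<le> real \<alpha>}"
  let ?B3 = "{\<alpha>. R 1 \<and> real \<alpha> \<le> sqrt q / L ^ 3}" let ?B4 = "{\<alpha>. R 1 \<and> sqrt q * L ^ 3 \<le> real \<alpha>}"
  let ?B5 = "{\<alpha>. R 2 \<and> real \<alpha> \<le> p * q / 8}" let ?B6 = "{\<alpha>. R 2 \<and> 40 * (p * q) \<le> real \<alpha>}"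
  have "measure_pmf.prob ?M (- ?good) \<le> measure_pmf.prob ?M (?B1 \<union> (?B2 \<union> (?B3 \<union> (?B4 \<union> (?B5 \<union> ?B6)))))"
  proof (intro measure_pmf.finite_measure_mono subsetI)
    fix \<alpha> assume "\<alpha> \<in> - ?good"
    then show "\<alpha> \<in> ?B1 \<union> (?B2 \<union> (?B3 \<union> (?B4 \<union> (?B5 \<union> ?B6))))"
      by (simp add: R_def) linarith
  qed simp
  also have "\<dots> \<le> (exp (- L / 4) + 8 / L\<^sup>2) + (exp (- L) + ((exp (- L / 4) + 8 / L\<^sup>2) +
      (exp (- sqrt q) + (exp (- sqrt q / 4) + exp (- sqrt q)))))"
    by (intro order.trans[OF measure_Un_le] add_mono restrict; ((rule tails; simp add: R_def) | simp))
  also have "\<dots> = ?e" by simp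
  finally have "measure_pmf.prob ?M (- ?good) \<le> ?e" .
  moreover have "measure_pmf.prob ?M (- ?good) = 1 - measure_pmf.prob ?M ?good"
    using measure_pmf.prob_compl[of ?good ?M] by (simp add: Compl_eq_Diff_UNIV)
  ultimately show ?thesis by linarith
qed

end

text \<open>These exponents make \<open>q\<^sup>\<epsilon> = (ln q)\<^sup>k\<close>; the cutoff at 3 keeps them nonnegative,
  since \<open>ln (ln q) < 0\<close> for \<open>q = 2\<close>.\<close>

definition loglog_exponent :: "nat \<Rightarrow> nat \<Rightarrow> real" where
  "loglog_exponent k q = (if 3 \<le> q then k * ln (ln (real q)) / ln (real q) else 0)"

lemma ln_ge_1: "3 \<le> q \<Longrightarrow> 1 \<le> ln (real q)"
  using exp_le by (subst ln_ge_iff) auto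

lemma powr_loglog_exponent:
  assumes "3 \<le> q"
  shows "real q powr loglog_exponent k q = ln (real q) ^ k"
proof -
  have "1 \<le> ln (real q)" using ln_ge_1[OF assms] .
  then have "exp (real k * ln (ln (real q))) = ln (real q) ^ k" by (simp add: exp_of_nat_mult)
  then show ?thesis using assms \<open>1 \<le> ln (real q)\<close> by (simp add: loglog_exponent_def powr_def)
qed

lemma polylog_exponent_loglog: "polylog_exponent (loglog_exponent k)"
  unfolding polylog_exponent_def
proof (intro conjI allI exI)
  show "0 \<le> loglog_exponent k q" for q
    using ln_ge_1[of q] by (auto simp: loglog_exponent_def)
  have "\<forall>\<^sub>F q in sequentially. loglog_exponent k q = real k * (ln (ln (real q)) / ln (real q))"
    using eventually_ge_at_top[of 3] by eventually_elim (simp add: loglog_exponent_def)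
  moreover have "(\<lambda>q. real k * (ln (ln (real q)) / ln (real q))) \<longlonglongrightarrow> real k * 0"
    by (intro tendsto_mult tendsto_const) real_asymp
  ultimately show "loglog_exponent k \<longlonglongrightarrow> 0" by (simp add: tendsto_cong)
  have "\<forall>\<^sub>F q in sequentially. real q powr loglog_exponent k q = ln (real q) ^ k"
    using eventually_ge_at_top[of 3] by eventually_elim (rule powr_loglog_exponent)
  then show "(\<lambda>q. real q powr loglog_exponent k q) \<in> O(\<lambda>q. ln (real q) ^ k)"
    by (intro bigoI[of _ 1]) (auto elim: eventually_mono)
qed

text \<open>These match the powers of \<open>q\<close> in the final statement with the logarithmic
  thresholds of the tail bounds: one logarithm at both sparse ends, two at the dense end, three in
  the middle window.\<close>

lemma powr_thresholds:
  assumes "3 \<le> q"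
  defines "L \<equiv> ln (real q)"
  shows "real q powr (-2 + loglog_exponent 1 q) = L / real q ^ 2"
    and "real q powr (-3/2 - loglog_exponent 1 q) = 1 / (q * sqrt q * L)"
    and "real q powr (-1/2 + loglog_exponent 2 q) = L\<^sup>2 / sqrt q"
    and "real q powr (1/2 - loglog_exponent 3 q) = sqrt q / L ^ 3"
    and "real q powr (1/2 + loglog_exponent 3 q) = sqrt q * L ^ 3"
proof -
  have q: "0 < real q" using assms by simp
  have "real q powr (3/2) = real q powr (1 + 1/2)" by simp
  also have "\<dots> = q * sqrt q" using q by (subst powr_add) (simp add: powr_half_sqrt)
  finally have 3: "real q powr (3/2) = q * sqrt q" .
  note e = powr_loglog_exponent[OF assms(1)]
  show "real q powr (-2 + loglog_exponent 1 q) = L / real q ^ 2"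
    using q powr_minus_divide[of "real q" 2] unfolding powr_add e by (simp add: L_def)
  show "real q powr (-3/2 - loglog_exponent 1 q) = 1 / (q * sqrt q * L)"
    using q powr_minus_divide[of "real q" "3/2"] by (simp add: powr_diff e L_def 3)
  show "real q powr (-1/2 + loglog_exponent 2 q) = L\<^sup>2 / sqrt q"
    using q powr_minus_divide[of "real q" "1/2"] unfolding powr_add e by (simp add: L_def powr_half_sqrt)
  show "real q powr (1/2 - loglog_exponent 3 q) = sqrt q / L ^ 3"
    using q by (simp add: powr_diff e L_def powr_half_sqrt)
  show "real q powr (1/2 + loglog_exponent 3 q) = sqrt q * L ^ 3"
    using q by (simp add: powr_add e L_def powr_half_sqrt)
qed

section \<open>Passage to the limit along prime powers\<close>

theorem theorem1p1:
  shows "\<exists>(\<epsilon>1 :: nat \<Rightarrow> real) \<epsilon>2 \<epsilon>3 \<epsilon>4 (c :: real) (C :: real).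
    polylog_exponent \<epsilon>1 \<and> polylog_exponent \<epsilon>2 \<and> polylog_exponent \<epsilon>3 \<and> polylog_exponent \<epsilon>4 \<and>
    0 < c \<and> 0 < C \<and>
    (\<forall>(F :: nat \<Rightarrow> 'a ring) (p :: nat \<Rightarrow> real).
      (\<forall>q. primepow q \<longrightarrow> field (F q) \<and> card (carrier (F q)) = q) \<longrightarrow>
      (\<forall>q. primepow q \<longrightarrow> 0 \<le> p q \<and> p q \<le> 1) \<longrightarrow>
      ((\<lambda>q. measure_pmf.prob (alpha_pmf (F q) (p q)) {\<alpha>.
          (real q powr (-2 + \<epsilon>1 q) \<le> p q \<and> p q \<le> real q powr (-3/2 - \<epsilon>2 q) \<longrightarrow>
             c * (p q * real q ^ 2) \<le> real \<alpha> \<and> real \<alpha> \<le> C * (p q * real q ^ 2)) \<and>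
          (real q powr (-3/2 - \<epsilon>2 q) \<le> p q \<and> p q \<le> real q powr (-1/2 + \<epsilon>3 q) \<longrightarrow>
             real q powr (1/2 - \<epsilon>4 q) \<le> real \<alpha> \<and> real \<alpha> \<le> real q powr (1/2 + \<epsilon>4 q)) \<and>
          (real q powr (-1/2 + \<epsilon>3 q) \<le> p q \<and> p q \<le> 1 \<longrightarrow>
             c * (p q * real q) \<le> real \<alpha> \<and> real \<alpha> \<le> C * (p q * real q))})
        \<longlongrightarrow> 1) prime_powers_at_top)"
proof (intro exI conjI allI impI)
  show "polylog_exponent (loglog_exponent 1)" "polylog_exponent (loglog_exponent 1)"
    "polylog_exponent (loglog_exponent 2)" "polylog_exponent (loglog_exponent 3)"
    by (rule polylog_exponent_loglog)+
  show "0 < (1 / 8 :: real)" "0 < (40 :: real)" by simp_all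
  fix F :: "nat \<Rightarrow> 'a ring" and p :: "nat \<Rightarrow> real"
  assume F: "\<forall>q. primepow q \<longrightarrow> field (F q) \<and> card (carrier (F q)) = q"
    and p: "\<forall>q. primepow q \<longrightarrow> 0 \<le> p q \<and> p q \<le> 1"
  let ?P = "\<lambda>q. measure_pmf.prob (alpha_pmf (F q) (p q)) {\<alpha>.
          (real q powr (-2 + loglog_exponent 1 q) \<le> p q \<and> p q \<le> real q powr (-3/2 - loglog_exponent 1 q) \<longrightarrow>
             1 / 8 * (p q * real q ^ 2) \<le> real \<alpha> \<and> real \<alpha> \<le> 40 * (p q * real q ^ 2)) \<and>
          (real q powr (-3/2 - loglog_exponent 1 q) \<le> p q \<and> p q \<le> real q powr (-1/2 + loglog_exponent 2 q) \<longrightarrow>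
             real q powr (1/2 - loglog_exponent 3 q) \<le> real \<alpha> \<and> real \<alpha> \<le> real q powr (1/2 + loglog_exponent 3 q)) \<and>
          (real q powr (-1/2 + loglog_exponent 2 q) \<le> p q \<and> p q \<le> 1 \<longrightarrow>
             1 / 8 * (p q * real q) \<le> real \<alpha> \<and> real \<alpha> \<le> 40 * (p q * real q))}"
  define e :: "nat \<Rightarrow> real" where "e q = 1 - (2 * exp (- ln q / 4) + 16 / (ln q)\<^sup>2 + exp (- ln q)
    + 2 * exp (- sqrt q) + exp (- sqrt q / 4))" for q
  have "\<forall>\<^sub>F q in at_top. primepow q \<longrightarrow> e q \<le> ?P q"
    using eventually_large_order eventually_ge_at_top[of 3]
  proof eventually_elim
    case (elim q)
    show ?case
    proof
      assume q: "primepow q"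
      then have c: "card (carrier (F q)) = q" and "field (F q)" and pq: "0 \<le> p q" "p q \<le> 1" using F p by auto
      \<comment> \<open>An infinite carrier would have \<open>card\<close> equal to 0.\<close>
      moreover have "finite (carrier (F q))" using c elim(2) by (intro card_ge_0_finite) simp
      ultimately have "finite_plane (F q)" by (simp add: finite_plane_def finite_plane_axioms_def)
      from finite_plane.prob_alpha_good[OF this pq, unfolded c, OF elim(1) refl]
      show "e q \<le> ?P q" unfolding powr_thresholds[OF elim(2)] e_def by (simp add: pq)
    qed
  qed
  then have low: "\<forall>\<^sub>F q in prime_powers_at_top. e q \<le> ?P q"
    unfolding prime_powers_at_top_def eventually_inf_principal by (rule eventually_mono) auto
  have "e \<longlonglongrightarrow> 1" unfolding e_def by real_asymp
  then have lim: "(e \<longlongrightarrow> 1) prime_powers_at_top"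
    unfolding prime_powers_at_top_def by (rule filterlim_mono) auto
  show "(?P \<longlongrightarrow> 1) prime_powers_at_top"
    by (rule tendsto_sandwich[OF low _ lim tendsto_const]) simp
qed

end
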